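(* Let $1\le k\le d-1$, let $\mu>0$, let $F:\mathbb{R}^d\to\mathbb{R}$ be a $\mathcal{C}^3$ functional, let $\boldsymbol{u}^*\in\mathbb{R}^d$ with $\overline{\boldsymbol{u}^*}=m$, and let $\boldsymbol{v}_1^*,\dots,\boldsymbol{v}_k^*\in\mathbb{R}^d_0$ be unit vectors, i.e. $\langle \boldsymbol{v}_i^*,\boldsymbol{v}_i^*\rangle_A=1$ for each $i$. Suppose that the Hessian $\nabla^2_AF(\boldsymbol{u}^* ):\mathbb{R}^d_0\to\mathbb{R}^d_0$ is nondegenerate (invertible), with eigenvalues (counted with multiplicity) $$\lambda_1^*\le\cdots\le\lambda_k^*<0<\lambda_{k+1}^*\le\cdots\le\lambda_{d-1}^*.$$ Then the following statements are equivalent: (A) $(\boldsymbol{u}^*,\boldsymbol{v}_1^*,\dots,\boldsymbol{v}_k^* )$ is a linearly stable steady state of the dynamical system for $(\boldsymbol{u},\boldsymbol{v}_1,\dots,\boldsymbol{v}_k)\in(\mathbb{R}^d)^{k+1}$ given by $$\begin{cases}\dot{\boldsymbol{u}}=-\Big(I-2\sum_{i=1}^{k}\boldsymbol{v}_i\boldsymbol{v}_i^{w,\top}A_0^{-1}\Big)\nabla_AF(\boldsymbol{u})-\mu(\overline{\boldsymbol{u}}-m)\boldsymbol{1},\\[4pt] \dot{\boldsymbol{v}}_i=-\Big(I-\boldsymbol{v}_i\boldsymbol{v}_i^{w,\top}A_0^{-1}-2\sum_{j=1}^{i-1}\boldsymbol{v}_j\boldsymbol{v}_j^{w,\top}A_0^{-1}\Big)\nabla^2_AF(\boldsymbol{u})[P_h\boldsymbol{v}_i],\quad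 i=1,\dots,k.\end{cases}$$ (B) $\boldsymbol{u}^*$ is an index-$k$ saddle point of $F$ (with respect to $\langle\cdot,\cdot\rangle_A$), and $\{\boldsymbol{v}_i^*\}_{i=1}^k$ are the eigenvectors of $\nabla^2_AF(\boldsymbol{u}^* )$ corresponding to the eigenvalues $\{\lambda_i^*\}_{i=1}^k$.
   Context: Fix weights $\boldsymbol{w}=(w_1,\dots,w_d)^\top$ with $w_i>0$, $\sum_{i=1}^d w_i=1$, and the inner product $\langle\boldsymbol{u},\boldsymbol{v}\rangle_w=\sum_{i=1}^d w_iu_iv_i$ on $\mathbb{R}^d$. Let $\boldsymbol{1}=(1,\dots,1)^\top$, $\overline{\boldsymbol{u}}=\langle\boldsymbol{u},\boldsymbol{1}\rangle_w$, $\mathbb{R}^d_0=\{\boldsymbol{u}\in\mathbb{R}^d:\langle\boldsymbol{1},\boldsymbol{u}\rangle_w=0\}$, and $P_h\boldsymbol{u}=\boldsymbol{u}-\overline{\boldsymbol{u}}\boldsymbol{1}$. The number $m\in\mathbb{R}$ is the prescribed conserved mean value (the mean $\overline{\boldsymbol{u}}(0)$ of the initial state). $A:\mathbb{R}^d\to\mathbb{R}^d$ is a fixed linear operator that is self-adjoint and positive semi-definite with respect to $\langle\cdot,\cdot\rangle_w$, with $\ker A=\operatorname{span}\{\boldsymbol{1}\}$. Its restriction $A_0:\mathbb{R}^d_0\to\mathbb{R}^d_0$ is invertible, self-adjoint and positive definite, with inverse $A_0^{-1}$. On $\mathbb{R}^d_0$ define $\langle\boldsymbol{u},\boldsymbol{v}\rangle_A=\langle\boldsymbol{u},A_0^{-1}\boldsymbol{v}\rangle_w$.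 $\nabla F(\boldsymbol{u})$ and $\nabla^2F(\boldsymbol{u})$ are the gradient and Hessian of $F$ with respect to $\langle\cdot,\cdot\rangle_w$. Put $\nabla_AF(\boldsymbol{u})=A\nabla F(\boldsymbol{u})$ and $\nabla^2_AF(\boldsymbol{u})=A\nabla^2F(\boldsymbol{u})$, the latter regarded as an operator $\mathbb{R}^d_0\to\mathbb{R}^d_0$; these are the gradient and Hessian of $F$ along $\boldsymbol{u}+\mathbb{R}^d_0$ with respect to $\langle\cdot,\cdot\rangle_A$. For $\boldsymbol{v}\in\mathbb{R}^d$, $\boldsymbol{v}^{w,\top}=(\boldsymbol{w}\circ\boldsymbol{v})^\top$ with $\circ$ the entrywise product, so $\boldsymbol{v}\boldsymbol{v}^{w,\top}A_0^{-1}$ is the map $\boldsymbol{x}\mapsto\langle\boldsymbol{v},A_0^{-1}\boldsymbol{x}\rangle_w\,\boldsymbol{v}$ for $\boldsymbol{x}\in\mathbb{R}^d_0$. A point $\boldsymbol{u}$ is an index-$k$ saddle point of $F$ with respect to $\langle\cdot,\cdot\rangle_A$ if $\nabla_AF(\boldsymbol{u})=0$ and $\nabla^2_AF(\boldsymbol{u}):\mathbb{R}^d_0\to\mathbb{R}^d_0$ is invertible with exactly $k$ negative eigenvalues (counted with multiplicity). A steady state of an autonomous system is a zero of its right-hand side; it is linearly stable if all eigenvalues of the Jacobian of the right-hand side at that point (here an operator on $(\mathbb{R}^d)^{k+1}$) have negative real part.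
   Formalization: In (B), "the eigenvectors" also requires each v_i* to be unique up to scalar for λ_i* (so λ_1*<…<λ_k* ). With merely some eigenvectors and a repeated negative eigenvalue, (B)⇒(A) fails: d=3, k=2, A=P_h, F=-⟨u,u⟩_w/2, u*=m1 gives Jacobian eigenvalue 0. *)

theory Defs
  imports "HOL-Analysis.Analysis"
begin

section \<open>Differentiability of order \<open>n\<close>\<close>

text \<open>
  In finite dimension, a function is of class \<open>C\<^sup>n\<^sup>+\<^sup>1\<close> iff it is differentiable and all its
  directional derivatives are of class \<open>C\<^sup>n\<close>.
\<close>

primrec C_class :: "nat \<Rightarrow> ('a::real_normed_vector \<Rightarrow> 'b::real_normed_vector) \<Rightarrow> bool" where
  "C_class 0 f \<longleftrightarrow> continuous_on UNIV f"
| "C_class (Suc n) f \<longleftrightarrow>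
     (\<forall>x. f differentiable (at x)) \<and> (\<forall>h. C_class n (\<lambda>x. frechet_derivative f (at x) h))"


section \<open>Spectra of operators on a subspace\<close>

text \<open>
  Algebraic multiplicity of \<open>l\<close> for \<open>T : S \<rightarrow> S\<close>: the dimension of the generalized eigenspace
  (zero if \<open>l\<close> is not an eigenvalue).
\<close>

definition eigen_mult_on :: "'a::real_vector set \<Rightarrow> ('a \<Rightarrow> 'a) \<Rightarrow> real \<Rightarrow> nat" where
  "eigen_mult_on S T l = dim {x \<in> S. \<exists>p. ((\<lambda>y. T y - l *\<^sub>R y) ^^ p) x = 0}"

definition eigenvector_on :: "'a::real_vector set \<Rightarrow> ('a \<Rightarrow> 'a) \<Rightarrow> real \<Rightarrow> 'a \<Rightarrow> bool" where
  "eigenvector_on S T l x \<longleftrightarrow> x \<in> S \<and> x \<noteq> 0 \<and> T x = l *\<^sub>R x"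

definition eigenvalue_on :: "'a::real_vector set \<Rightarrow> ('a \<Rightarrow> 'a) \<Rightarrow> real \<Rightarrow> bool" where
  "eigenvalue_on S T l \<longleftrightarrow> (\<exists>x. eigenvector_on S T l x)"

text \<open>
  \<open>lam 1 \<le> \<dots> \<le> lam (dim S)\<close> are all the eigenvalues of \<open>T : S \<rightarrow> S\<close>, each repeated according to
  its multiplicity.
\<close>

definition eigenvalue_list_on :: "'a::real_vector set \<Rightarrow> ('a \<Rightarrow> 'a) \<Rightarrow> (nat \<Rightarrow> real) \<Rightarrow> bool" where
  "eigenvalue_list_on S T lam \<longleftrightarrow>
     mono_on {1..dim S} lam \<and>
     (\<forall>l. card {i \<in> {1..dim S}. lam i = l} = eigen_mult_on S T l)"

definition num_neg_eigenvalues_on :: "'a::real_vector set \<Rightarrow> ('a \<Rightarrow> 'a) \<Rightarrow> nat" where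
  "num_neg_eigenvalues_on S T = (\<Sum>l | eigenvalue_on S T l \<and> l < 0. eigen_mult_on S T l)"

text \<open>
  \<open>x\<close> is \<^emph>\<open>the\<close> eigenvector for the eigenvalue \<open>l\<close>, i.e. it is determined by \<open>l\<close> up to a scalar
  (up to sign, once it is normalized). Uniqueness matters: if one of the negative eigenvalues is
  repeated, the linearization of \<open>saddle_field\<close> below at a corresponding saddle point has the
  eigenvalue \<open>0\<close>.
\<close>

definition the_eigenvector_on :: "'a::real_vector set \<Rightarrow> ('a \<Rightarrow> 'a) \<Rightarrow> real \<Rightarrow> 'a \<Rightarrow> bool" where
  "the_eigenvector_on S T l x \<longleftrightarrow>
     eigenvector_on S T l x \<and> (\<forall>y. eigenvector_on S T l y \<longrightarrow> (\<exists>c. y = c *\<^sub>R x))"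


section \<open>Linear stability\<close>

text \<open>
  Complex eigenvalues of a real linear operator, i.e. eigenvalues of its complexification:
  \<open>J x + \<i> J y = c (x + \<i> y)\<close> with \<open>x + \<i> y \<noteq> 0\<close>, split into real and imaginary part.
\<close>

definition complex_eigenvalue :: "('a::real_vector \<Rightarrow> 'a) \<Rightarrow> complex \<Rightarrow> bool" where
  "complex_eigenvalue J c \<longleftrightarrow>
     (\<exists>x y. (x \<noteq> 0 \<or> y \<noteq> 0) \<and>
        J x = Re c *\<^sub>R x - Im c *\<^sub>R y \<and> J y = Im c *\<^sub>R x + Re c *\<^sub>R y)"

definition linearly_stable_steady_state :: "('a::real_normed_vector \<Rightarrow> 'a) \<Rightarrow> 'a \<Rightarrow> bool" where
  "linearly_stable_steady_state f z \<longleftrightarrow>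
     f z = 0 \<and>
     (\<exists>J. (f has_derivative J) (at z) \<and> (\<forall>c. complex_eigenvalue J c \<longrightarrow> Re c < 0))"


section \<open>The weighted space\<close>

definition winner :: "real ^ 'n \<Rightarrow> real ^ 'n \<Rightarrow> real ^ 'n \<Rightarrow> real" where
  "winner w u v = (\<Sum>i\<in>UNIV. w $ i * u $ i * v $ i)"

definition wmean :: "real ^ 'n \<Rightarrow> real ^ 'n \<Rightarrow> real" where
  "wmean w u = winner w u 1"

definition R0 :: "real ^ 'n \<Rightarrow> (real ^ 'n) set" where
  "R0 w = {u. winner w 1 u = 0}"

definition Ph :: "real ^ 'n \<Rightarrow> real ^ 'n \<Rightarrow> real ^ 'n" where
  "Ph w u = u - wmean w u *\<^sub>R 1"

text \<open>The inverse of the restriction \<open>A\<^sub>0 : R0 w \<rightarrow> R0 w\<close> of \<open>A\<close>; only meaningful on \<open>R0 w\<close>.\<close>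

definition A0_inv :: "real ^ 'n \<Rightarrow> (real ^ 'n \<Rightarrow> real ^ 'n) \<Rightarrow> real ^ 'n \<Rightarrow> real ^ 'n" where
  "A0_inv w A = the_inv_into (R0 w) A"

definition Ainner ::
  "real ^ 'n \<Rightarrow> (real ^ 'n \<Rightarrow> real ^ 'n) \<Rightarrow> real ^ 'n \<Rightarrow> real ^ 'n \<Rightarrow> real" where
  "Ainner w A u v = winner w u (A0_inv w A v)"

definition wgrad :: "real ^ 'n \<Rightarrow> (real ^ 'n \<Rightarrow> real) \<Rightarrow> real ^ 'n \<Rightarrow> real ^ 'n" where
  "wgrad w F u = (THE g. (F has_derivative (\<lambda>h. winner w g h)) (at u))"

definition whess :: "real ^ 'n \<Rightarrow> (real ^ 'n \<Rightarrow> real) \<Rightarrow> real ^ 'n \<Rightarrow> real ^ 'n \<Rightarrow> real ^ 'n" where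
  "whess w F u = frechet_derivative (wgrad w F) (at u)"

definition Agrad ::
  "real ^ 'n \<Rightarrow> (real ^ 'n \<Rightarrow> real ^ 'n) \<Rightarrow> (real ^ 'n \<Rightarrow> real) \<Rightarrow> real ^ 'n \<Rightarrow> real ^ 'n" where
  "Agrad w A F u = A (wgrad w F u)"

definition Ahess ::
  "real ^ 'n \<Rightarrow> (real ^ 'n \<Rightarrow> real ^ 'n) \<Rightarrow> (real ^ 'n \<Rightarrow> real) \<Rightarrow> real ^ 'n \<Rightarrow> real ^ 'n \<Rightarrow> real ^ 'n"
  where "Ahess w A F u h = A (whess w F u h)"

definition index_saddle ::
  "real ^ 'n \<Rightarrow> (real ^ 'n \<Rightarrow> real ^ 'n) \<Rightarrow> (real ^ 'n \<Rightarrow> real) \<Rightarrow> nat \<Rightarrow> real ^ 'n \<Rightarrow> bool" where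
  "index_saddle w A F k u \<longleftrightarrow>
     Agrad w A F u = 0 \<and>
     bij_betw (Ahess w A F u) (R0 w) (R0 w) \<and>
     num_neg_eigenvalues_on (R0 w) (Ahess w A F u) = k"


section \<open>The dynamical system\<close>

text \<open>The operator \<open>v v\<^sup>w\<^sup>,\<^sup>T A\<^sub>0\<^sup>-\<^sup>1\<close>, to be applied to \<open>x \<in> R0 w\<close>; \<open>v\<close> need not lie in \<open>R0 w\<close>.\<close>

definition rank1 ::
  "real ^ 'n \<Rightarrow> (real ^ 'n \<Rightarrow> real ^ 'n) \<Rightarrow> real ^ 'n \<Rightarrow> real ^ 'n \<Rightarrow> real ^ 'n" where
  "rank1 w A v x = winner w v (A0_inv w A x) *\<^sub>R v"

text \<open>
  The directions \<open>v\<^sub>1, \<dots>, v\<^sub>k\<close> are indexed by a finite linearly ordered type \<open>'k\<close> of cardinality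
  \<open>k\<close>, so that the state space \<open>(\<real>\<^sup>d)\<^sup>k\<^sup>+\<^sup>1\<close> is a normed space.
\<close>

definition saddle_field ::
  "real ^ 'n \<Rightarrow> (real ^ 'n \<Rightarrow> real ^ 'n) \<Rightarrow> (real ^ 'n \<Rightarrow> real) \<Rightarrow> real \<Rightarrow> real \<Rightarrow>
   (real ^ 'n) \<times> (real ^ 'n ^ 'k::{finite,linorder}) \<Rightarrow> (real ^ 'n) \<times> (real ^ 'n ^ 'k::{finite,linorder})" where
  "saddle_field w A F \<mu> m = (\<lambda>(u, v).
     ( - (Agrad w A F u - 2 *\<^sub>R (\<Sum>i\<in>UNIV. rank1 w A (v $ i) (Agrad w A F u)))
         - (\<mu> * (wmean w u - m)) *\<^sub>R 1,
       \<chi> i. let h = Ahess w A F u (Ph w (v $ i)) in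
         - (h - rank1 w A (v $ i) h - 2 *\<^sub>R (\<Sum>j | j < i. rank1 w A (v $ j) h))))"

text \<open>The position, in \<open>{1..k}\<close>, of an index in the linear order of \<open>'k\<close>.\<close>

definition pos :: "'k::{finite,linorder} \<Rightarrow> nat" where
  "pos i = card {j. j \<le> i}"

end

theory Submission
  imports Defs
begin

text \<open>
  Write \<open>H\<close> for the Hessian, which is self-adjoint for the \<open>A\<close>-inner product. At a stationary
  point, put \<open>a\<^sub>i = \<langle>v\<^sub>i, H v\<^sub>i\<rangle>\<close>. By induction on \<open>i\<close>, testing the equation for \<open>v\<^sub>i\<close> with the
  earlier \<open>v\<^sub>j\<close> and with \<open>v\<^sub>i\<close> itself yields \<open>a\<^sub>i \<Sum>\<^sub>j \<langle>v\<^sub>j, v\<^sub>i\<rangle>\<^sup>2 = 0\<close>; since \<open>H\<close> is invertible, the \<open>v\<^sub>i\<close>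
  are orthonormal eigenvectors with eigenvalues \<open>a\<^sub>i\<close>, and then the gradient vanishes.

  The linearization at such a point is block triangular. It has the eigenvalues \<open>2 a\<^sub>i\<close> and
  \<open>a\<^sub>j - a\<^sub>l\<close> for \<open>j < l\<close>, so stability forces \<open>a\<^sub>1 < \<dots> < a\<^sub>k < 0\<close>; as there are only \<open>k\<close>
  negative eigenvalues, these are all of them, and they are simple. Conversely, if
  \<open>a\<^sub>1 < \<dots> < a\<^sub>k < 0\<close> and \<open>H\<close> is positive on the orthogonal complement of the \<open>v\<^sub>i\<close>, then every
  diagonal block has a negative definite quadratic form on the mean-zero space and acts by a
  negative scalar on means, so no complex eigenvalue has nonnegative real part.
\<close>

section \<open>Symmetry of second derivatives\<close>

text \<open>The mixed second difference is the increment over \<open>[0, t]\<close> of the map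
  taking \<open>s\<close> to \<open>F (u + s x + t y) - F (u + s x)\<close>. One mean value step in
  \<open>s\<close> and a second one in the direction \<open>y\<close> turn it into a single mixed
  derivative.\<close>

lemma second_difference_mvt:
  fixes F :: "'a::real_normed_vector \<Rightarrow> real"
  assumes F: "\<And>z. (F has_derivative F' z) (at z)"
    and F': "\<And>z. ((\<lambda>z. F' z x) has_derivative F'' z) (at z)"
    and t: "0 < t"
  obtains \<xi> \<eta> where "0 < \<xi>" "\<xi> < t" "0 < \<eta>" "\<eta> < t"
    "F (u + t *\<^sub>R x + t *\<^sub>R y) - F (u + t *\<^sub>R x) - F (u + t *\<^sub>R y) + F u
      = t * (t * F'' (u + \<xi> *\<^sub>R x + \<eta> *\<^sub>R y) y)"
proof -
  have lin: "linear (F' z)" "linear (F'' z)" for z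
    using F F' has_derivative_linear by blast+
  have line: "((\<lambda>s. u + s *\<^sub>R x + r *\<^sub>R y) has_derivative (\<lambda>h. h *\<^sub>R x)) (at s)"
    "((\<lambda>r. u + s *\<^sub>R x + r *\<^sub>R y) has_derivative (\<lambda>h. h *\<^sub>R y)) (at r)" for s r :: real
    by (auto intro!: derivative_eq_intros)
  have F_line: "((\<lambda>s. F (u + s *\<^sub>R x + r *\<^sub>R y)) has_real_derivative F' (u + s *\<^sub>R x + r *\<^sub>R y) x) (at s)" for s r
    using has_derivative_compose[OF line(1) F, of r s]
    by (simp add: has_field_derivative_def linear_scale[OF lin(1)] mult.commute[of _ "F' _ _"])
  have F'_line: "((\<lambda>r. F' (u + s *\<^sub>R x + r *\<^sub>R y) x) has_real_derivative F'' (u + s *\<^sub>R x + r *\<^sub>R y) y) (at r)" for s r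
    using has_derivative_compose[OF line(2) F', of s r]
    by (simp add: has_field_derivative_def linear_scale[OF lin(2)] mult.commute[of _ "F'' _ _"])
  obtain \<xi> where \<xi>: "0 < \<xi>" "\<xi> < t"
    "(F (u + t *\<^sub>R x + t *\<^sub>R y) - F (u + t *\<^sub>R x + 0 *\<^sub>R y))
      - (F (u + 0 *\<^sub>R x + t *\<^sub>R y) - F (u + 0 *\<^sub>R x + 0 *\<^sub>R y))
      = (t - 0) * (F' (u + \<xi> *\<^sub>R x + t *\<^sub>R y) x - F' (u + \<xi> *\<^sub>R x + 0 *\<^sub>R y) x)"
    using MVT2[OF t DERIV_diff[OF F_line[of t] F_line[of 0]]] by blast
  obtain \<eta> where "0 < \<eta>" "\<eta> < t"
    "F' (u + \<xi> *\<^sub>R x + t *\<^sub>R y) x - F' (u + \<xi> *\<^sub>R x + 0 *\<^sub>R y) x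
      = (t - 0) * F'' (u + \<xi> *\<^sub>R x + \<eta> *\<^sub>R y) y"
    using MVT2[OF t F'_line[of \<xi>]] by blast
  with \<xi> show ?thesis
    by (intro that[of \<xi> \<eta>]) auto
qed

text \<open>The second difference is unchanged when \<open>x\<close> and \<open>y\<close> are
  exchanged, so the two mixed derivatives take equal values at two points of a small parallelogram
  at \<open>u\<close>. Continuity at \<open>u\<close> then forbids a gap between them.\<close>

lemma second_derivative_symmetric:
  fixes F :: "'a::real_normed_vector \<Rightarrow> real"
  assumes F: "\<And>z. (F has_derivative F' z) (at z)"
    and F': "\<And>z h. ((\<lambda>z. F' z h) has_derivative F'' h z) (at z)"
    and cont: "\<And>h h'. isCont (\<lambda>z. F'' h z h') u"
  shows "F'' x u y = F'' y u x"
proof (rule ccontr)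
  assume ne: "F'' x u y \<noteq> F'' y u x"
  define e where "e = \<bar>F'' x u y - F'' y u x\<bar> / 2"
  have "e > 0" using ne by (simp add: e_def)
  obtain d1 where d1: "d1 > 0" "\<And>z. dist z u < d1 \<Longrightarrow> dist (F'' x z y) (F'' x u y) < e"
    using cont[of x y] \<open>e > 0\<close> unfolding continuous_at_eps_delta by blast
  obtain d2 where d2: "d2 > 0" "\<And>z. dist z u < d2 \<Longrightarrow> dist (F'' y z x) (F'' y u x) < e"
    using cont[of y x] \<open>e > 0\<close> unfolding continuous_at_eps_delta by blast
  \<comment> \<open>Scaling by \<open>N\<close> keeps the parallelogram with sides
    \<open>t x\<close> and \<open>t y\<close> within \<open>min d1 d2\<close> of \<open>u\<close>;
    the summand 1 makes the divisor positive even for \<open>x = y = 0\<close>.\<close>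
  define N where "N = norm x + norm y + 1"
  have N: "N > 0" by (simp add: N_def add_nonneg_pos)
  define t where "t = min d1 d2 / N"
  have t: "t > 0" using d1(1) d2(1) N by (simp add: t_def)
  have near: "dist (u + a *\<^sub>R x + b *\<^sub>R y) u < min d1 d2" if "0 < a" "a < t" "0 < b" "b < t" for a b
  proof -
    have "dist (u + a *\<^sub>R x + b *\<^sub>R y) u \<le> a * norm x + b * norm y"
      using norm_triangle_ineq[of "a *\<^sub>R x" "b *\<^sub>R y"] that by (simp add: dist_norm algebra_simps)
    also have "\<dots> \<le> t * norm x + t * norm y"
      using that by (intro add_mono mult_right_mono) auto
    also have "\<dots> < t * N" using t by (simp add: N_def algebra_simps)
    also have "\<dots> = min d1 d2" using N by (simp add: t_def)
    finally show ?thesis .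
  qed
  obtain a b where ab: "0 < a" "a < t" "0 < b" "b < t"
    "F (u + t *\<^sub>R x + t *\<^sub>R y) - F (u + t *\<^sub>R x) - F (u + t *\<^sub>R y) + F u = t * (t * F'' x (u + a *\<^sub>R x + b *\<^sub>R y) y)"
    using second_difference_mvt[OF F F' t, where x = x and y = y and u = u] by metis
  obtain c d where cd: "0 < c" "c < t" "0 < d" "d < t"
    "F (u + t *\<^sub>R y + t *\<^sub>R x) - F (u + t *\<^sub>R y) - F (u + t *\<^sub>R x) + F u = t * (t * F'' y (u + c *\<^sub>R y + d *\<^sub>R x) x)"
    using second_difference_mvt[OF F F' t, where x = y and y = x and u = u] by metis
  have swap: "u + p *\<^sub>R y + q *\<^sub>R x = u + q *\<^sub>R x + p *\<^sub>R y" for p q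
    by (simp add: add_ac)
  have "t * (t * F'' x (u + a *\<^sub>R x + b *\<^sub>R y) y) = t * (t * F'' y (u + d *\<^sub>R x + c *\<^sub>R y) x)"
    using ab(5) cd(5) unfolding swap[of t t] swap[of c d] by linarith
  then have "F'' x (u + a *\<^sub>R x + b *\<^sub>R y) y = F'' y (u + d *\<^sub>R x + c *\<^sub>R y) x"
    using t by simp
  moreover have "dist (F'' x (u + a *\<^sub>R x + b *\<^sub>R y) y) (F'' x u y) < e"
    using near[OF ab(1-4)] by (intro d1) auto
  moreover have "dist (F'' y (u + d *\<^sub>R x + c *\<^sub>R y) x) (F'' y u x) < e"
    using near[OF cd(3,4) cd(1,2)] by (intro d2) auto
  ultimately show False
    unfolding e_def dist_real_def by (simp add: abs_if split: if_splits)
qed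

section \<open>Gradient and Hessian in the weighted inner product\<close>

text \<open>A vector is the sum of its components embedded by \<open>axis\<close>, and these
  embeddings are isometric, hence bounded linear. Used both for coordinates of a gradient and for
  families of directions.\<close>

lemma has_derivative_vec_lambda:
  fixes f :: "'i::finite \<Rightarrow> 'a::real_normed_vector \<Rightarrow> 'b::real_normed_vector"
  assumes "\<And>i. (f i has_derivative f' i) (at x within S)"
  shows "((\<lambda>x. \<chi> i. f i x) has_derivative (\<lambda>h. \<chi> i. f' i h)) (at x within S)"
proof -
  have *: "(\<chi> i. g i) = (\<Sum>i\<in>UNIV. axis i (g i))" for g :: "'i \<Rightarrow> 'b"
    by (simp add: vec_eq_iff axis_def sum.delta)
  have "norm (axis i x :: 'b ^ 'i) = norm x" for i x
  proof -
    have "(norm (axis i x $ j))\<^sup>2 = (if j = i then (norm x)\<^sup>2 else 0)" for j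
      by (simp add: axis_def)
    then show ?thesis by (simp add: norm_vec_def L2_set_def sum.delta)
  qed
  then have "bounded_linear (axis i :: 'b \<Rightarrow> 'b ^ 'i)" for i
    by (intro bounded_linear_intro[of _ 1]) (auto simp: axis_def vec_eq_iff)
  then show ?thesis
    unfolding * by (intro has_derivative_sum bounded_linear.has_derivative[where f = "axis _"] assms)
qed

lemma bounded_bilinear_winner: "bounded_bilinear (winner w)"
proof -
  have "bilinear (winner w)"
    unfolding bilinear_def winner_def
    by (intro conjI allI linearI) (simp_all add: algebra_simps sum.distrib sum_distrib_left)
  then show ?thesis by (simp add: bilinear_conv_bounded_bilinear)
qed

lemma winner_commute: "winner w x y = winner w y x"
  by (simp add: winner_def ac_simps)

lemma winner_axis:
  "winner w (axis i 1) y = w $ i * y $ i" "winner w y (axis i 1) = w $ i * y $ i"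
  by (simp_all add: winner_def axis_def if_distrib if_distribR sum.delta cong: if_cong)

lemma winner_pos_def:
  assumes "\<And>i. 0 < w $ i"
  shows "0 \<le> winner w x x" "winner w x x = 0 \<longleftrightarrow> x = 0"
proof -
  have *: "winner w x x = (\<Sum>i\<in>UNIV. w $ i * (x $ i)\<^sup>2)"
    by (simp add: winner_def power2_eq_square mult.assoc)
  have nn: "0 \<le> w $ i * (x $ i)\<^sup>2" for i
    using assms[of i] by simp
  show "0 \<le> winner w x x" unfolding * using nn by (simp add: sum_nonneg)
  have "winner w x x = 0 \<longleftrightarrow> (\<forall>i\<in>UNIV. w $ i * (x $ i)\<^sup>2 = 0)"
    unfolding * using nn by (intro sum_nonneg_eq_0_iff) auto
  also have "\<dots> \<longleftrightarrow> x = 0"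
    using assms by (auto simp: vec_eq_iff less_imp_neq[symmetric])
  finally show "winner w x x = 0 \<longleftrightarrow> x = 0" .
qed

lemma winner_eqI:
  assumes "\<And>i. 0 < w $ i" "\<And>h. winner w x h = winner w y h"
  shows "x = y"
proof -
  have "x $ i = y $ i" for i
    using assms(1)[of i] assms(2)[of "axis i 1"] by (simp add: winner_axis)
  then show ?thesis by (simp add: vec_eq_iff)
qed

context
  fixes w :: "real ^ 'n" and F :: "real ^ 'n \<Rightarrow> real"
  assumes w_pos: "\<And>i. 0 < w $ i" and F_C3: "C_class 3 F"
begin

private abbreviation "D1 u \<equiv> frechet_derivative F (at u)"
private abbreviation "D2 h u \<equiv> frechet_derivative (\<lambda>u. D1 u h) (at u)"

private lemma C3:
  "(F has_derivative D1 u) (at u)"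
  "((\<lambda>u. D1 u h) has_derivative D2 h u) (at u)"
  "(\<lambda>u. D2 h u h') differentiable (at u)"
  using F_C3 by (simp_all add: numeral_3_eq_3 frechet_derivative_works[symmetric])

text \<open>Riesz representation for the weighted product: dividing the partial derivatives by the
  weights cancels the weights in \<open>winner\<close>. Uniqueness of derivatives resolves the
  definite description.\<close>

private lemma wgrad_eq: "wgrad w F u = (\<chi> i. D1 u (axis i 1) / w $ i)"
proof -
  define g where "g = (\<chi> i. D1 u (axis i 1) / w $ i)"
  have nz: "w $ i \<noteq> 0" for i using w_pos[of i] by simp
  have "D1 u h = winner w g h" for h
  proof -
    have "D1 u h = D1 u (\<Sum>i\<in>UNIV. h $ i *\<^sub>R axis i 1)"
      by (simp add: basis_expansion scalar_mult_eq_scaleR[symmetric])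
    also have "\<dots> = (\<Sum>i\<in>UNIV. h $ i *\<^sub>R D1 u (axis i 1))"
      using has_derivative_linear[OF C3(1)] by (simp add: linear_sum linear_scale)
    also have "\<dots> = winner w g h"
      by (simp add: winner_def nz g_def mult.commute)
    finally show ?thesis .
  qed
  then have *: "D1 u = winner w g" by (rule ext)
  have "wgrad w F u = g" unfolding wgrad_def
  proof (rule the_equality)
    show g: "(F has_derivative winner w g) (at u)" using C3(1)[of u] unfolding * .
    fix g' assume "(F has_derivative winner w g') (at u)"
    then have "winner w g' = winner w g"
      using g by (rule has_derivative_unique)
    then show "g' = g" by (intro winner_eqI[OF w_pos]) (rule fun_cong)
  qed
  then show ?thesis unfolding g_def .
qed

private lemma wgrad_has_derivative':
  "(wgrad w F has_derivative (\<lambda>h. \<chi> i. D2 (axis i 1) u h / w $ i)) (at u)"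
  unfolding wgrad_eq[abs_def] divide_inverse
  by (intro has_derivative_vec_lambda has_derivative_mult_left C3)

private lemma whess_eq: "whess w F u h = (\<chi> i. D2 (axis i 1) u h / w $ i)"
  unfolding whess_def by (subst frechet_derivative_at[OF wgrad_has_derivative', symmetric]) (rule refl)

lemma wgrad_has_derivative: "(wgrad w F has_derivative whess w F u) (at u)"
  using wgrad_has_derivative' unfolding whess_eq[abs_def] .

lemma whess_linear: "linear (whess w F u)"
  using has_derivative_linear[OF wgrad_has_derivative] .

lemma whess_differentiable: "(\<lambda>u. whess w F u h) differentiable (at u)"
proof -
  define E where "E i = frechet_derivative (\<lambda>u. D2 (axis i 1) u h) (at u)" for i
  have "((\<lambda>u. D2 (axis i 1) u h) has_derivative E i) (at u)" for i
    using C3(3) unfolding E_def by (simp add: frechet_derivative_works)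
  then have "((\<lambda>u. \<chi> i. D2 (axis i 1) u h * inverse (w $ i)) has_derivative
      (\<lambda>z. \<chi> i. E i z * inverse (w $ i))) (at u)"
    by (intro has_derivative_vec_lambda has_derivative_mult_left)
  then show ?thesis
    unfolding whess_eq divide_inverse differentiable_def by blast
qed

text \<open>Paired by \<open>winner\<close>, the weights cancel and the plain second derivative of
  \<open>F\<close> remains. It is continuous because its directional values are differentiable, so
  it is symmetric.\<close>

lemma whess_selfadjoint: "winner w (whess w F u x) y = winner w x (whess w F u y)"
proof -
  have nz: "w $ i \<noteq> 0" for i using w_pos[of i] by simp
  have D2_sym: "D2 h u h' = D2 h' u h" for h h'
    using second_derivative_symmetric[of F "\<lambda>u. D1 u" "\<lambda>h u. D2 h u" u, OF C3(1,2)]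
      differentiable_imp_continuous_within[OF C3(3)] by blast
  have lin: "linear (D2 h u)" for h
    using has_derivative_linear[OF C3(2)] .
  have *: "winner w (whess w F u a) b = D2 a u b" for a b
  proof -
    have "winner w (whess w F u a) b = (\<Sum>i\<in>UNIV. b $ i *\<^sub>R D2 a u (axis i 1))"
      by (simp add: winner_def whess_eq nz D2_sym[of a] mult.commute)
    also have "\<dots> = D2 a u (\<Sum>i\<in>UNIV. b $ i *\<^sub>R axis i 1)"
      by (simp add: linear_sum[OF lin] linear_scale[OF lin])
    also have "\<dots> = D2 a u b"
      by (simp add: basis_expansion scalar_mult_eq_scaleR[symmetric])
    finally show ?thesis .
  qed
  show ?thesis
    using *[of x y] *[of y x] by (simp add: D2_sym[of x] winner_commute)
qed

end

section \<open>Self-adjoint operators on a subspace\<close>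

text \<open>A null vector of a nonnegative form lies in its radical: if \<open>q x y\<close> were
  nonzero, a small move from \<open>x\<close> along \<open>y\<close> would make the form
  negative.\<close>

lemma semidefinite_form_zero:
  fixes q :: "'a::real_vector \<Rightarrow> 'a \<Rightarrow> real"
  assumes S: "subspace S" and q: "bilinear q"
    and sym: "\<And>x y. x \<in> S \<Longrightarrow> y \<in> S \<Longrightarrow> q x y = q y x"
    and nonneg: "\<And>x. x \<in> S \<Longrightarrow> 0 \<le> q x x"
    and x: "x \<in> S" "q x x = 0" and y: "y \<in> S"
  shows "q x y = 0"
proof (rule ccontr)
  assume ne: "q x y \<noteq> 0"
  define b c where "b = q x y" and "c = q y y"
  \<comment> \<open>With this choice the form at \<open>x + t y\<close> equals
    \<open>t * (b - t)\<close>, that is, minus \<open>t * t * (c + 2)\<close>. The shift by 1 covers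
    the case \<open>c = 0\<close>.\<close>
  define t where "t = - b / (c + 1)"
  have "c \<ge> 0" using nonneg[OF y] by (simp add: c_def)
  then have t: "t * (c + 1) = - b" by (simp add: t_def)
  have "0 \<le> q (x + t *\<^sub>R y) (x + t *\<^sub>R y)"
    using S x y by (intro nonneg) (simp add: subspace_add subspace_scale)
  also have "\<dots> = 2 * (t * b) + t * t * c"
    using sym[OF x(1) y] x(2)
    by (simp add: bilinear_ladd[OF q] bilinear_radd[OF q] bilinear_lmul[OF q] bilinear_rmul[OF q]
        b_def c_def algebra_simps)
  also have "\<dots> = t * (b + (t * (c + 1) + b) - t)" by (simp add: algebra_simps)
  also have "\<dots> = t * (b - t)" unfolding t by simp
  also have "\<dots> < 0"
  proof -
    have b: "b = - (t * (c + 1))" using t by simp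
    have "t * (b - t) = - (t * t * (c + 2))" unfolding b by (simp add: algebra_simps)
    moreover have "t \<noteq> 0" using b ne by (auto simp: b_def)
    then have "0 < t * t" by (auto simp: zero_less_mult_iff)
    then have "0 < t * t * (c + 2)" using \<open>c \<ge> 0\<close> by simp
    ultimately show ?thesis by simp
  qed
  finally show False by simp
qed

text \<open>Bilinearity and symmetry hold everywhere, positivity only on \<open>S\<close>. This
  admits a degenerate extension of the A-inner product, which perturbations with nonzero mean
  require.\<close>

locale inner_on_subspace = ip: bounded_bilinear ip
  for ip :: "'a::euclidean_space \<Rightarrow> 'a \<Rightarrow> real" +
  fixes S :: "'a set"
  assumes subspace_S: "subspace S"
    and ip_sym: "ip x y = ip y x"
    and ip_pos: "x \<in> S \<Longrightarrow> x \<noteq> 0 \<Longrightarrow> 0 < ip x x"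
begin

lemma ip_self_nonneg: "x \<in> S \<Longrightarrow> 0 \<le> ip x x"
  using ip_pos[of x] by (cases "x = 0") (auto simp: ip.zero_left)

lemma ip_self_eq_0: "x \<in> S \<Longrightarrow> ip x x = 0 \<longleftrightarrow> x = 0"
  using ip_pos[of x] ip.zero_left by force

text \<open>The Rayleigh quotient attains its minimum \<open>l\<close> on the Euclidean unit sphere
  of \<open>W\<close>, and by homogeneity the bound holds on all of \<open>W\<close>. The form of
  \<open>H - l\<close> is then nonnegative with null vector \<open>x\<close>; testing with the
  residual \<open>H x - l x\<close> shows that the residual vanishes.\<close>

lemma rayleigh_minimizer:
  assumes W: "subspace W" "W \<subseteq> S" "W \<noteq> {0}"
    and H: "linear H" "\<And>x. x \<in> W \<Longrightarrow> H x \<in> W"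
    and selfadj: "\<And>x y. x \<in> W \<Longrightarrow> y \<in> W \<Longrightarrow> ip (H x) y = ip x (H y)"
  obtains l x where "x \<in> W" "x \<noteq> 0" "H x = l *\<^sub>R x" "\<And>y. y \<in> W \<Longrightarrow> l * ip y y \<le> ip y (H y)"
proof -
  define f where "f x = ip x (H x) / ip x x" for x
  let ?K = "W \<inter> sphere 0 1"
  obtain z where z: "z \<in> W" "z \<noteq> 0" using W(1,3) subspace_0 by fastforce
  then have "(1 / norm z) *\<^sub>R z \<in> ?K" using W(1) by (auto intro: subspace_scale)
  then have ne: "?K \<noteq> {}" by blast
  have compact: "compact ?K"
    by (intro closed_Int_compact closed_subspace W compact_sphere)
  have pos: "0 < ip x x" if "x \<in> W" "x \<noteq> 0" for x using that W(2) ip_pos by blast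
  have bl: "bounded_linear H" using H(1) by (simp add: linear_conv_bounded_linear)
  have cont: "continuous_on ?K f"
    unfolding f_def
    by (intro continuous_intros ip.continuous_on bounded_linear.continuous_on[OF bl])
      (use pos in fastforce)
  obtain x where x: "x \<in> ?K" "\<And>y. y \<in> ?K \<Longrightarrow> f x \<le> f y"
    using continuous_attains_inf[OF compact ne cont] by blast
  define l where "l = f x"
  have xW: "x \<in> W" "x \<noteq> 0" using x(1) by auto
  have lower: "l * ip y y \<le> ip y (H y)" if y: "y \<in> W" for y
  proof (cases "y = 0")
    case False
    define r where "r = 1 / norm y"
    have r: "r > 0" "r *\<^sub>R y \<in> ?K" using False y W(1) by (auto simp: r_def subspace_scale)
    have "f (r *\<^sub>R y) = f y"
      using r(1) by (simp add: f_def linear_scale[OF H(1)] ip.scaleR_left ip.scaleR_right)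
    then have "l \<le> f y" using x(2)[OF r(2)] by (simp add: l_def)
    then show ?thesis using pos[OF y False] by (simp add: f_def field_simps)
  qed (simp add: ip.zero_left)
  define q where "q a b = ip a (H b) - l * ip a b" for a b
  have q_eq: "q a b = ip a (H b - l *\<^sub>R b)" for a b
    by (simp add: q_def ip.diff_right ip.scaleR_right)
  have "bilinear q"
    unfolding bilinear_def q_def
    by (intro conjI allI linearI)
      (simp_all add: linear_add[OF H(1)] linear_scale[OF H(1)] ip.add_left ip.scaleR_left
        ip.add_right ip.scaleR_right algebra_simps)
  moreover have "q a b = q b a" if "a \<in> W" "b \<in> W" for a b
    using selfadj[OF that] ip_sym[of "H a" b] by (simp add: q_def ip.diff_right ip.scaleR_right ip_sym[of a b])
  moreover have "0 \<le> q a a" if "a \<in> W" for a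
    using lower[OF that] by (simp add: q_def ip.diff_right ip.scaleR_right)
  moreover have "q x x = 0"
    using pos[OF xW] by (simp add: q_def ip.diff_right ip.scaleR_right l_def f_def)
  ultimately have zero: "q x y = 0" if "y \<in> W" for y
    using semidefinite_form_zero[OF W(1)] xW that by metis
  define d where "d = H x - l *\<^sub>R x"
  have d: "d \<in> W" unfolding d_def using W(1) H(2) xW by (simp add: subspace_diff subspace_scale)
  have "q x d = ip (H x - l *\<^sub>R x) d"
    using selfadj[OF xW(1) d] by (simp add: q_def ip.diff_left ip.scaleR_left)
  then have "q x d = ip d d" by (simp add: d_def)
  then have "d = 0" using zero[OF d] d W(2) ip_self_eq_0 by auto
  then show ?thesis using that[OF xW _ lower] by (simp add: d_def)
qed

text \<open>Testing the two real equations with \<open>x\<close> and \<open>y\<close> and adding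
  cancels the terms with \<open>Im c\<close> by symmetry of \<open>ip\<close>. \<open>T\<close>
  itself may be far from self-adjoint.\<close>

lemma complex_eigenvalue_negative_form:
  assumes neg: "\<And>x. x \<in> S \<Longrightarrow> x \<noteq> 0 \<Longrightarrow> ip x (T x) < 0"
    and xy: "x \<in> S" "y \<in> S" "x \<noteq> 0 \<or> y \<noteq> 0"
    and T: "T x = Re c *\<^sub>R x - Im c *\<^sub>R y" "T y = Im c *\<^sub>R x + Re c *\<^sub>R y"
  shows "Re c < 0"
proof -
  have "ip x (T x) + ip y (T y) = Re c * (ip x x + ip y y)"
    unfolding T by (simp add: ip.diff_right ip.add_right ip.scaleR_right ip_sym[of y x] algebra_simps)
  moreover have "ip z (T z) \<le> 0" if "z \<in> S" for z
    using neg[OF that] by (cases "z = 0") (auto simp: ip.zero_left)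
  from this[OF xy(1)] this[OF xy(2)] have "ip x (T x) + ip y (T y) < 0"
    using neg[of x] neg[of y] xy by fastforce
  moreover have "0 \<le> ip x x + ip y y" using xy ip_self_nonneg by (simp add: add_nonneg_nonneg)
  ultimately show ?thesis by (metis linorder_not_less mult_nonneg_nonneg)
qed

end

locale selfadjoint_on_subspace = inner_on_subspace ip S
  for ip :: "'a::euclidean_space \<Rightarrow> 'a \<Rightarrow> real" and S +
  fixes H :: "'a \<Rightarrow> 'a"
  assumes linear_H: "linear H"
    and H_in_S: "H x \<in> S"
    and H_selfadj: "x \<in> S \<Longrightarrow> y \<in> S \<Longrightarrow> ip (H x) y = ip x (H y)"
begin

lemma eigenvectors_orthogonal:
  assumes "x \<in> S" "y \<in> S" "H x = a *\<^sub>R x" "H y = b *\<^sub>R y" "a \<noteq> b"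
  shows "ip x y = 0"
  using H_selfadj[OF assms(1,2)] assms(3-5) by (simp add: ip.scaleR_left ip.scaleR_right)

text \<open>Self-adjointness excludes Jordan blocks: if \<open>N = H - l\<close> kills
  \<open>N x\<close>, then \<open>ip (N x) (N x) = ip x (N (N x)) = 0\<close>.\<close>

lemma generalized_eigenvector_imp_eigenvector:
  assumes x: "x \<in> S" "((\<lambda>y. H y - l *\<^sub>R y) ^^ p) x = 0"
  shows "H x = l *\<^sub>R x"
  using x
proof (induction p arbitrary: x)
  case 0
  then show ?case by (simp add: linear_0[OF linear_H])
next
  case (Suc p)
  let ?N = "\<lambda>y. H y - l *\<^sub>R y"
  have N: "?N x \<in> S"
    using Suc.prems subspace_S H_in_S by (simp add: subspace_diff subspace_scale)
  have "(?N ^^ p) (?N x) = 0" using Suc.prems(2) by (simp only: funpow_Suc_right o_apply)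
  then have "H (?N x) = l *\<^sub>R ?N x" using Suc.IH N by blast
  then have "ip (?N x) (?N x) = 0"
    using H_selfadj[OF Suc.prems(1) N]
    by (simp add: ip.diff_left ip.scaleR_left) (simp add: ip.scaleR_right)
  then show ?case using ip_self_eq_0[OF N] by simp
qed

lemma stationary_directions:
  fixes v :: "'k::{finite,linorder} \<Rightarrow> 'a"
  defines "\<alpha> i \<equiv> ip (v i) (H (v i))"
  assumes inj: "\<And>x. x \<in> S \<Longrightarrow> H x = 0 \<Longrightarrow> x = 0"
    and v: "\<And>i. v i \<in> S" "\<And>i. ip (v i) (v i) = 1"
    and stationary: "\<And>i. H (v i) = ip (v i) (H (v i)) *\<^sub>R v i
        + 2 *\<^sub>R (\<Sum>j | j < i. ip (v j) (H (v i)) *\<^sub>R v j)"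
  shows "H (v i) = \<alpha> i *\<^sub>R v i \<and> (\<forall>j<i. ip (v j) (v i) = 0)"
\<comment> \<open>Strong induction along the finite linear order, measured by the number of
  predecessors.\<close>
proof (induction i rule: measure_induct_rule[where f = "\<lambda>i. card {j. j < i}"])
  case (less i)
  have IH: "H (v j) = \<alpha> j *\<^sub>R v j" "l < j \<Longrightarrow> ip (v l) (v j) = 0" if "j < i" for j l
  proof -
    have "{l. l < j} \<subset> {l. l < i}" using that by auto
    then have "card {l. l < j} < card {l. l < i}" by (intro psubset_card_mono) auto
    from less[OF this] show "H (v j) = \<alpha> j *\<^sub>R v j" "l < j \<Longrightarrow> ip (v l) (v j) = 0"
      by blast+
  qed
  have orth: "ip (v l) (v j) = (if j = l then 1 else 0)" if "l < i" "j < i" for l j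
    using IH(2)[of j l] IH(2)[of l j] that v(2) ip_sym[of "v l" "v j"] by (cases l j rule: linorder_cases) auto
  define c where "c j = ip (v j) (v i)" for j
  have ipH: "ip (v j) (H (v i)) = \<alpha> j * c j" if "j < i" for j
    using H_selfadj[OF v(1) v(1), of j i] IH(1)[OF that] by (simp add: c_def ip.scaleR_left)
  have "H (v i) = \<alpha> i *\<^sub>R v i + 2 *\<^sub>R (\<Sum>j | j < i. ip (v j) (H (v i)) *\<^sub>R v j)"
    using stationary[of i] by (simp add: \<alpha>_def)
  also have "(\<Sum>j | j < i. ip (v j) (H (v i)) *\<^sub>R v j) = (\<Sum>j | j < i. (\<alpha> j * c j) *\<^sub>R v j)"
    by (intro sum.cong) (auto simp: ipH)
  finally have Hv: "H (v i) = \<alpha> i *\<^sub>R v i + 2 *\<^sub>R (\<Sum>j | j < i. (\<alpha> j * c j) *\<^sub>R v j)" .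
  have nz: "H (v j) \<noteq> 0" for j using inj[OF v(1)[of j]] v(2)[of j] by (auto simp: ip.zero_left)
  \<comment> \<open>Testing with an earlier \<open>v l\<close> reproduces the left side twice on the
    right, because of the factor 2 of the reflection. Hence the sign change.\<close>
  have flip: "\<alpha> l * c l = - \<alpha> i * c l" if l: "l < i" for l
  proof -
    have "\<alpha> l * c l = ip (v l) (H (v i))" using ipH[OF l] by simp
    also have "\<dots> = \<alpha> i * c l + 2 * (\<Sum>j | j < i. \<alpha> j * c j * ip (v l) (v j))"
      by (subst Hv) (simp add: ip.add_right ip.scaleR_right ip.sum_right c_def)
    also have "(\<Sum>j | j < i. \<alpha> j * c j * ip (v l) (v j)) = (\<Sum>j | j < i. if j = l then \<alpha> l * c l else 0)"
      by (intro sum.cong) (auto simp: orth l)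
    also have "\<dots> = \<alpha> l * c l" using l by (simp add: sum.delta)
    finally show ?thesis by simp
  qed
  have "\<alpha> i = ip (v i) (H (v i))" by (simp add: \<alpha>_def)
  also have "\<dots> = \<alpha> i + 2 * (\<Sum>j | j < i. \<alpha> j * c j * c j)"
    by (subst Hv) (simp add: ip.add_right ip.scaleR_right ip.sum_right c_def v(2) ip_sym[of "v i"])
  also have "(\<Sum>j | j < i. \<alpha> j * c j * c j) = - \<alpha> i * (\<Sum>j | j < i. (c j)\<^sup>2)"
    unfolding sum_distrib_left by (intro sum.cong) (auto simp: flip power2_eq_square)
  finally have "\<alpha> i * (\<Sum>j | j < i. (c j)\<^sup>2) = 0" by simp
  \<comment> \<open>If \<open>\<alpha> i = 0\<close>, the sign relation kills every coefficient
    \<open>\<alpha> j * c j\<close>, so \<open>H (v i) = 0\<close>, against injectivity.\<close>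
  moreover have "\<alpha> i \<noteq> 0"
  proof
    assume "\<alpha> i = 0"
    then have "H (v i) = 0"
      using flip by (subst Hv) (simp add: sum.neutral)
    then show False using nz by blast
  qed
  ultimately have "(\<Sum>j | j < i. (c j)\<^sup>2) = 0" by simp
  then have "\<forall>j\<in>{j. j < i}. (c j)\<^sup>2 = 0" by (subst (asm) sum_nonneg_eq_0_iff) auto
  then have c0: "c j = 0" if "j < i" for j using that by simp
  then have "H (v i) = \<alpha> i *\<^sub>R v i"
    by (subst Hv) (simp add: sum.neutral)
  then show ?case using c0 by (simp add: c_def)
qed

end

section \<open>Orthonormal families of eigenvectors and quadratic forms adapted to them\<close>

locale eigenframe = selfadjoint_on_subspace ip S H
  for ip :: "'a::euclidean_space \<Rightarrow> 'a \<Rightarrow> real" and S H +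
  fixes v :: "'k::finite \<Rightarrow> 'a" and \<alpha> :: "'k \<Rightarrow> real"
  assumes v_in_S: "v i \<in> S"
    and orthonormal: "ip (v i) (v j) = (if i = j then 1 else 0)"
    and eigen: "H (v i) = \<alpha> i *\<^sub>R v i"
begin

lemma ip_sum_frame: "ip (v i) (\<Sum>j\<in>UNIV. c j *\<^sub>R v j) = c i"
proof -
  have "ip (v i) (\<Sum>j\<in>UNIV. c j *\<^sub>R v j) = (\<Sum>j\<in>UNIV. if j = i then c j else 0)"
    by (simp add: ip.sum_right ip.scaleR_right orthonormal if_distrib cong: if_cong)
  then show ?thesis by (simp add: sum.delta)
qed

text \<open>The orthogonal complement of the frame is invariant under \<open>H\<close>, so its
  Rayleigh minimum is an eigenvalue. If that were nonpositive, the minimizer would be a multiple of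
  some \<open>v i\<close>, yet orthogonal to it.\<close>

lemma complement_positive:
  assumes nonpos: "\<And>x l. x \<in> S \<Longrightarrow> x \<noteq> 0 \<Longrightarrow> H x = l *\<^sub>R x \<Longrightarrow> l \<le> 0 \<Longrightarrow> \<exists>i c. x = c *\<^sub>R v i"
    and r: "r \<in> S" "r \<noteq> 0" "\<And>j. ip (v j) r = 0"
  shows "0 < ip r (H r)"
proof -
  define W where "W = {r \<in> S. \<forall>j. ip (v j) r = 0}"
  have W: "subspace W" "W \<subseteq> S" "W \<noteq> {0}"
    using subspace_S r unfolding W_def subspace_def
    by (auto simp: ip.zero_right ip.add_right ip.scaleR_right)
  have "H x \<in> W" if "x \<in> W" for x
    using that H_in_S H_selfadj[OF v_in_S, of x] by (auto simp: W_def eigen ip.scaleR_left)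
  with W obtain l x where x: "x \<in> W" "x \<noteq> 0" "H x = l *\<^sub>R x"
    and lower: "\<And>y. y \<in> W \<Longrightarrow> l * ip y y \<le> ip y (H y)"
    using rayleigh_minimizer[OF W linear_H] H_selfadj by (metis subsetD)
  have "l > 0"
  proof (rule ccontr)
    assume "\<not> l > 0"
    then obtain i c where c: "x = c *\<^sub>R v i" using nonpos x W(2) by (meson not_less subsetD)
    then have "ip (v i) x = c" by (simp add: ip.scaleR_right orthonormal)
    then show False using x(1,2) c by (auto simp: W_def)
  qed
  moreover have "r \<in> W" using r by (simp add: W_def)
  ultimately show ?thesis using lower[of r] ip_pos[OF r(1,2)] by (smt (verit) mult_pos_pos)
qed

text \<open>The operator acts by scalars on the frame and as \<open>s - H\<close> on its complement,
  so the form splits. The block of the state is the case \<open>s = 0\<close>,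
  \<open>M = UNIV\<close>; the block of the direction \<open>i\<close> is
  \<open>s = \<alpha> i\<close>, \<open>M = {j. j \<le> i}\<close>.\<close>

lemma block_form_negative:
  assumes complement: "\<And>r. r \<in> S \<Longrightarrow> r \<noteq> 0 \<Longrightarrow> (\<And>j. ip (v j) r = 0) \<Longrightarrow> 0 < ip r (H r)"
    and s: "s \<le> 0" "\<And>j. j \<notin> M \<Longrightarrow> s < \<alpha> j" "\<And>j. j \<in> M \<Longrightarrow> s + \<alpha> j < 0"
    and x: "x \<in> S" "x \<noteq> 0"
  shows "ip x (s *\<^sub>R x - H x + 2 *\<^sub>R (\<Sum>j\<in>M. (\<alpha> j * ip (v j) x) *\<^sub>R v j)) < 0"
proof -
  define c where "c j = ip (v j) x" for j
  define p where "p = (\<Sum>j\<in>UNIV. c j *\<^sub>R v j)"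
  define r where "r = x - p"
  have pS: "p \<in> S" unfolding p_def using subspace_S v_in_S by (intro subspace_sum subspace_scale)
  have rS: "r \<in> S" unfolding r_def using subspace_S x pS by (intro subspace_diff)
  have vr: "ip (v j) r = 0" for j
    by (simp add: r_def ip.diff_right p_def ip_sum_frame) (simp add: c_def)
  have ipp: "ip y p = (\<Sum>j\<in>UNIV. c j * ip (v j) y)" for y
    by (simp add: p_def ip.sum_right ip.scaleR_right ip_sym[of y])
  have ipHp: "ip y (H p) = (\<Sum>j\<in>UNIV. \<alpha> j * c j * ip (v j) y)" for y
    by (simp add: p_def linear_sum[OF linear_H] linear_scale[OF linear_H] eigen ip.sum_right
        ip.scaleR_right ip_sym[of y] mult_ac)
  have x_eq: "x = p + r" by (simp add: r_def)
  have vp: "ip (v j) p = c j" for j unfolding p_def by (rule ip_sum_frame)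
  have ipr: "ip r p = 0" "ip r (H p) = 0" unfolding ipp ipHp by (simp_all add: vr)
  have ippr: "ip p (H r) = 0" using H_selfadj[OF pS rS] ipr(2) ip_sym by metis
  have "ip p p = (\<Sum>j\<in>UNIV. (c j)\<^sup>2)" using ipp[of p] by (simp add: vp power2_eq_square)
  then have xx: "ip x x = (\<Sum>j\<in>UNIV. (c j)\<^sup>2) + ip r r"
    unfolding x_eq ip.add_left ip.add_right using ipr(1) ip_sym[of p r] by simp
  have "ip x (H x) = ip p (H p) + ip r (H r)"
    unfolding x_eq linear_add[OF linear_H] ip.add_left ip.add_right using ipr(2) ippr by simp
  then have xHx: "ip x (H x) = (\<Sum>j\<in>UNIV. \<alpha> j * (c j)\<^sup>2) + ip r (H r)"
    by (simp add: ipHp vp power2_eq_square mult.assoc)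
  \<comment> \<open>The eigenvalue of the operator on \<open>v j\<close>:
    \<open>s + \<alpha> j\<close> for \<open>j\<close> in \<open>M\<close>, and
    \<open>s - \<alpha> j\<close> otherwise.\<close>
  define \<gamma> where "\<gamma> j = s - \<alpha> j + (if j \<in> M then 2 * \<alpha> j else 0)" for j
  have \<gamma>: "\<gamma> j < 0" for j using s(2,3)[of j] by (auto simp: \<gamma>_def)
  have "ip x (\<Sum>j\<in>M. (\<alpha> j * ip (v j) x) *\<^sub>R v j) = (\<Sum>j\<in>M. \<alpha> j * (c j)\<^sup>2)"
    by (simp add: ip.sum_right ip.scaleR_right ip_sym[of x] c_def power2_eq_square mult.assoc)
  also have "\<dots> = (\<Sum>j\<in>UNIV. (if j \<in> M then \<alpha> j else 0) * (c j)\<^sup>2)"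
    by (intro sum.mono_neutral_cong_left) auto
  finally have "ip x (s *\<^sub>R x - H x + 2 *\<^sub>R (\<Sum>j\<in>M. (\<alpha> j * ip (v j) x) *\<^sub>R v j))
      = s * ip x x - ip x (H x) + 2 * (\<Sum>j\<in>UNIV. (if j \<in> M then \<alpha> j else 0) * (c j)\<^sup>2)"
    by (simp add: ip.add_right ip.diff_right ip.scaleR_right)
  also have "\<dots> = (\<Sum>j\<in>UNIV. \<gamma> j * (c j)\<^sup>2) + (s * ip r r - ip r (H r))"
  proof -
    have "(\<Sum>j\<in>UNIV. \<gamma> j * (c j)\<^sup>2) = (\<Sum>j\<in>UNIV. s * (c j)\<^sup>2 - \<alpha> j * (c j)\<^sup>2
        + 2 * ((if j \<in> M then \<alpha> j else 0) * (c j)\<^sup>2))"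
      by (intro sum.cong) (auto simp: \<gamma>_def algebra_simps)
    then show ?thesis
      by (simp add: xx xHx sum.distrib sum_subtractf sum_distrib_left distrib_left)
  qed
  also have "\<dots> < 0"
  proof (cases "r = 0")
    case True
    have "\<exists>j. c j \<noteq> 0"
    proof (rule ccontr)
      assume "\<nexists>j. c j \<noteq> 0"
      then have "x = 0" using True x_eq by (simp add: p_def)
      then show False using x(2) by simp
    qed
    then obtain j where "c j \<noteq> 0" ..
    then have "\<gamma> j * (c j)\<^sup>2 < 0" using \<gamma> by (simp add: mult_neg_pos)
    then have "(\<Sum>j\<in>UNIV. \<gamma> j * (c j)\<^sup>2) < (\<Sum>j\<in>(UNIV::'k set). 0)"
      using \<gamma> by (intro sum_strict_mono_ex1) (auto simp: mult_nonpos_nonneg less_imp_le)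
    then show ?thesis using True by (simp add: ip.zero_left)
  next
    case False
    have "(\<Sum>j\<in>UNIV. \<gamma> j * (c j)\<^sup>2) \<le> 0"
      using \<gamma> by (intro sum_nonpos) (simp add: mult_nonpos_nonneg less_imp_le)
    moreover have "s * ip r r \<le> 0" using s(1) ip_self_nonneg[OF rS] by (rule mult_nonpos_nonneg)
    moreover have "0 < ip r (H r)" using complement[OF rS False vr] .
    ultimately show ?thesis by linarith
  qed
  finally show ?thesis .
qed

end

text \<open>\<open>T\<close> acts as the scalar \<open>\<gamma>\<close> modulo \<open>S\<close>. An
  eigenvector with both parts in \<open>S\<close> is handled by the form; any other has a nonzero
  complex mean, and comparing means gives \<open>Re c = \<gamma>\<close>.\<close>

lemma (in inner_on_subspace) complex_eigenvalue_block:
  assumes mean: "linear mean" "\<And>x. mean x = 0 \<longleftrightarrow> x \<in> S" "\<And>x. mean (T x) = \<gamma> * mean x"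
    and \<gamma>: "\<gamma> < (0::real)"
    and neg: "\<And>x. x \<in> S \<Longrightarrow> x \<noteq> 0 \<Longrightarrow> ip x (T x) < 0"
    and xy: "x \<noteq> 0 \<or> y \<noteq> 0" "T x = Re c *\<^sub>R x - Im c *\<^sub>R y" "T y = Im c *\<^sub>R x + Re c *\<^sub>R y"
  shows "Re c < 0"
proof (cases "mean x = 0 \<and> mean y = 0")
  case True
  then show ?thesis
    using complex_eigenvalue_negative_form[OF neg _ _ xy] mean(2) by blast
next
  case False
  have "\<gamma> * mean x = Re c * mean x - Im c * mean y" "\<gamma> * mean y = Im c * mean x + Re c * mean y"
    using xy(2,3)[THEN arg_cong[where f = mean]]
    by (simp_all add: mean(3) linear_diff[OF mean(1)] linear_add[OF mean(1)] linear_scale[OF mean(1)])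
  then have "\<gamma> * (mean x * mean x + mean y * mean y) = Re c * (mean x * mean x + mean y * mean y)"
    by (simp add: distrib_left mult.assoc[symmetric] left_diff_distrib distrib_right)
  moreover have "mean x * mean x + mean y * mean y \<noteq> 0" using False by simp
  ultimately have "Re c = \<gamma>" by auto
  then show ?thesis using \<gamma> by simp
qed

section \<open>Spectrum of the linearized saddle dynamics\<close>

text \<open>\<open>e\<close> stands for the vector of ones and \<open>P\<close> for the projection
  onto mean zero. \<open>E i\<close> is the derivative of the Hessian in the base point, applied to
  \<open>v i\<close>; it couples the state into the directions below the diagonal, so it drops out
  of the spectrum.\<close>

locale saddle_linearization = eigenframe ip S H v \<alpha>
  for ip :: "'a::euclidean_space \<Rightarrow> 'a \<Rightarrow> real" and S H
    and v :: "'k::{finite,linorder} \<Rightarrow> 'a" and \<alpha> +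
  fixes mean :: "'a \<Rightarrow> real" and P :: "'a \<Rightarrow> 'a" and e :: 'a and E :: "'k \<Rightarrow> 'a \<Rightarrow> 'a" and \<mu> :: real
  assumes linear_mean: "linear mean"
    and mean_eq_0: "mean x = 0 \<longleftrightarrow> x \<in> S"
    and mean_e: "mean e = 1"
    and P_eq: "P x = x - mean x *\<^sub>R e"
    and ip_P: "ip x (P y) = ip x y"
    and E_0: "E i 0 = 0"
begin

text \<open>The product rule at a point where the gradient vanishes and
  \<open>H (v i) = \<alpha> i v i\<close>. The local \<open>k\<close> is the variation of the
  Hessian term. Differentiating the outer factor leaves \<open>\<alpha> i b i\<close> in the term of
  \<open>v i\<close> itself and nothing for \<open>j < i\<close>, by orthonormality.\<close>

definition J :: "'a \<times> ('a ^ 'k::{finite,linorder}) \<Rightarrow> 'a \<times> ('a ^ 'k::{finite,linorder})" where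
  "J = (\<lambda>(a, b).
     (- (H a - 2 *\<^sub>R (\<Sum>i\<in>UNIV. ip (v i) (H a) *\<^sub>R v i)) - (\<mu> * mean a) *\<^sub>R e,
      \<chi> i. let k = E i a + H (P (b $ i)) in
        - (k - (\<alpha> i *\<^sub>R b $ i + (ip (v i) k + \<alpha> i * ip (b $ i) (v i)) *\<^sub>R v i)
           - 2 *\<^sub>R (\<Sum>j | j < i. (ip (v j) k + \<alpha> i * ip (b $ j) (v i)) *\<^sub>R v j))))"

lemma P_on_S: "x \<in> S \<Longrightarrow> P x = x"
  using mean_eq_0[of x] by (simp add: P_eq)

lemma P_in_S: "P x \<in> S"
  using mean_eq_0[of "P x"]
  by (simp add: P_eq linear_diff[OF linear_mean] linear_scale[OF linear_mean] mean_e)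

lemma mean_S: "x \<in> S \<Longrightarrow> mean x = 0"
  using mean_eq_0 by blast

lemma ip_v_H: "x \<in> S \<Longrightarrow> ip (v i) (H x) = \<alpha> i * ip (v i) x"
  using H_selfadj[OF v_in_S, of x i] by (simp add: eigen ip.scaleR_left)

lemma fst_J: "fst (J (a, b)) = - H a + 2 *\<^sub>R (\<Sum>i\<in>UNIV. ip (v i) (H a) *\<^sub>R v i) - (\<mu> * mean a) *\<^sub>R e"
  by (simp add: J_def)

text \<open>For a perturbation of the directions alone, row \<open>i\<close> involves only
  components with index at most \<open>i\<close>: the linearization is block triangular.\<close>

lemma snd_J: "snd (J (0, b)) $ i = \<alpha> i *\<^sub>R b $ i - H (P (b $ i)) + 2 *\<^sub>R (\<alpha> i * ip (v i) (b $ i)) *\<^sub>R v i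
    + 2 *\<^sub>R (\<Sum>j | j < i. (\<alpha> j * ip (v j) (b $ i) + \<alpha> i * ip (b $ j) (v i)) *\<^sub>R v j)"
  using ip_sym[of "b $ i" "v i"]
  by (simp add: J_def E_0 Let_def ip_v_H[OF P_in_S] ip_P scaleR_2 algebra_simps del: scaleR_scaleR)

lemma J_0: "J (0, 0) = 0"
  by (auto simp: prod_eq_iff fst_J linear_0[OF linear_H] linear_0[OF linear_mean] vec_eq_iff snd_J
      P_on_S subspace_0[OF subspace_S] ip.zero_left ip.zero_right)

lemma complex_eigenvalue_J_real:
  assumes "J (0, b) = l *\<^sub>R (0, b)" "b \<noteq> 0"
  shows "complex_eigenvalue J (of_real l)"
  unfolding complex_eigenvalue_def
  by (rule exI[of _ "(0, b)"], rule exI[of _ 0])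
    (use assms J_0 in \<open>simp add: zero_prod_def[symmetric]\<close>, simp add: zero_prod_def)

lemma v_nonzero: "v i \<noteq> 0"
  using orthonormal[of i i] by (auto simp: ip.zero_left)

text \<open>Rescaling \<open>v i\<close> alone is an eigenvector with eigenvalue
  \<open>2 * \<alpha> i\<close>: the first two terms of row \<open>i\<close> cancel and the rank-one
  term remains.\<close>

lemma stable_imp_alpha_neg:
  assumes "\<And>c. complex_eigenvalue J c \<Longrightarrow> Re c < 0"
  shows "\<alpha> i < 0"
proof -
  let ?b = "axis i (v i)"
  have "J (0, ?b) = (2 * \<alpha> i) *\<^sub>R (0, ?b)"
  proof (rule prod_eqI)
    show "fst (J (0, ?b)) = fst ((2 * \<alpha> i) *\<^sub>R (0, ?b))"
      by (simp add: fst_J linear_0[OF linear_H] linear_0[OF linear_mean] ip.zero_right)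
    have "snd (J (0, ?b)) $ l = (2 * \<alpha> i) *\<^sub>R (?b $ l)" for l
    proof (cases "l = i")
      case True
      have "(\<alpha> j * ip (v j) (?b $ i) + \<alpha> i * ip (?b $ j) (v i)) *\<^sub>R v j = 0" if "j < i" for j
        using that by (auto simp: axis_def orthonormal ip.zero_left)
      then show ?thesis
        unfolding snd_J True by (simp add: P_on_S v_in_S eigen orthonormal sum.neutral algebra_simps)
    next
      case False
      have "(\<alpha> j * ip (v j) (?b $ l) + \<alpha> l * ip (?b $ j) (v l)) *\<^sub>R v j = 0" for j
        using False by (auto simp: axis_def orthonormal ip.zero_left ip.zero_right)
      then show ?thesis
        unfolding snd_J using False
        by (simp add: axis_def P_on_S subspace_0[OF subspace_S] linear_0[OF linear_H] ip.zero_right sum.neutral)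
    qed
    then show "snd (J (0, ?b)) = snd ((2 * \<alpha> i) *\<^sub>R (0, ?b))"
      by (simp add: vec_eq_iff)
  qed
  moreover have "?b \<noteq> 0" using v_nonzero by (simp add: axis_eq_0_iff)
  ultimately show ?thesis
    using assms[OF complex_eigenvalue_J_real] by fastforce
qed

text \<open>The eigenvector is the infinitesimal rotation exchanging the directions \<open>j\<close> and \<open>l\<close>.\<close>

lemma stable_imp_alpha_less:
  assumes stable: "\<And>c. complex_eigenvalue J c \<Longrightarrow> Re c < 0" and jl: "j < l"
  shows "\<alpha> j < \<alpha> l"
proof -
  define b :: "'a ^ 'k::{finite,linorder}" where "b = (\<chi> i. if i = j then v l else if i = l then - v j else 0)"
  have b: "b $ j = v l" "b $ l = - v j" "i \<noteq> j \<Longrightarrow> i \<noteq> l \<Longrightarrow> b $ i = 0" for i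
    using jl by (auto simp: b_def)
  have ne: "j \<noteq> l" "l \<noteq> j" using jl by auto
  have "J (0, b) = (\<alpha> j - \<alpha> l) *\<^sub>R (0, b)"
  proof (rule prod_eqI)
    show "fst (J (0, b)) = fst ((\<alpha> j - \<alpha> l) *\<^sub>R (0, b))"
      by (simp add: fst_J linear_0[OF linear_H] linear_0[OF linear_mean] ip.zero_right)
    have "snd (J (0, b)) $ i = (\<alpha> j - \<alpha> l) *\<^sub>R (b $ i)" for i
    proof -
      consider "i = j" | "i = l" | "i \<noteq> j" "i \<noteq> l" by blast
      then show ?thesis
      proof cases
        case 1
        have "(\<alpha> m * ip (v m) (b $ j) + \<alpha> j * ip (b $ m) (v j)) *\<^sub>R v m = 0" if "m < j" for m
          using that jl b(3)[of m] by (auto simp: b orthonormal ip.zero_left)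
        then have sum: "(\<Sum>m | m < j. (\<alpha> m * ip (v m) (b $ j) + \<alpha> j * ip (b $ m) (v j)) *\<^sub>R v m) = 0"
          by (intro sum.neutral) auto
        show ?thesis
          unfolding snd_J 1 sum using ne
          by (simp add: b P_on_S v_in_S eigen orthonormal algebra_simps)
      next
        case 2
        \<comment> \<open>Only \<open>m = j\<close> contributes. Doubled, this coupling outweighs
          the diagonal part \<open>(\<alpha> j - \<alpha> l) v j\<close> and reverses its sign,
          which matches the component \<open>- v j\<close> of \<open>b\<close>.\<close>
        have "(\<alpha> m * ip (v m) (b $ l) + \<alpha> l * ip (b $ m) (v l)) *\<^sub>R v m
            = (if m = j then (\<alpha> l - \<alpha> j) *\<^sub>R v j else 0)" if "m < l" for m
          using that jl b(3)[of m] by (auto simp: b orthonormal ip.zero_left ip.minus_right)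
        then have sum: "(\<Sum>m | m < l. (\<alpha> m * ip (v m) (b $ l) + \<alpha> l * ip (b $ m) (v l)) *\<^sub>R v m)
            = (\<alpha> l - \<alpha> j) *\<^sub>R v j"
          using jl by (subst sum.cong[OF refl]) (auto simp: sum.delta)
        show ?thesis
          unfolding snd_J 2 sum using ne
          by (simp add: b P_on_S v_in_S subspace_neg[OF subspace_S] linear_neg[OF linear_H] eigen orthonormal
              ip.minus_right algebra_simps scaleR_2 del: scaleR_scaleR)
      next
        case 3
        have "(\<alpha> m * ip (v m) (b $ i) + \<alpha> i * ip (b $ m) (v i)) *\<^sub>R v m = 0" for m
          using 3 b(3)[of m] by (cases "m = j"; cases "m = l")
            (auto simp: b orthonormal ip.zero_left ip.zero_right ip.minus_left)
        then show ?thesis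
          unfolding snd_J using 3
          by (simp add: b P_on_S subspace_0[OF subspace_S] linear_0[OF linear_H] ip.zero_right sum.neutral)
      qed
    qed
    then show "snd (J (0, b)) = snd ((\<alpha> j - \<alpha> l) *\<^sub>R (0, b))"
      by (simp add: vec_eq_iff)
  qed
  moreover have "b \<noteq> 0" using b(1) v_nonzero[of l] by auto
  ultimately show ?thesis
    using stable[OF complex_eigenvalue_J_real] by fastforce
qed

text \<open>By triangularity, the first nonzero component of an eigenvector is an eigenvector of a
  diagonal block. That block has a negative form on \<open>S\<close> and acts on means by
  \<open>- \<mu>\<close> or by \<open>\<alpha> i\<close>.\<close>

lemma stable_if_frame_ordered:
  assumes complement: "\<And>r. r \<in> S \<Longrightarrow> r \<noteq> 0 \<Longrightarrow> (\<And>j. ip (v j) r = 0) \<Longrightarrow> 0 < ip r (H r)"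
    and neg: "\<And>i. \<alpha> i < 0" and less: "\<And>i j. i < j \<Longrightarrow> \<alpha> i < \<alpha> j"
    and \<mu>: "0 < \<mu>"
    and c: "complex_eigenvalue J c"
  shows "Re c < 0"
proof -
  obtain a b a' b' where nz: "(a, b) \<noteq> 0 \<or> (a', b') \<noteq> 0"
    and J: "J (a, b) = Re c *\<^sub>R (a, b) - Im c *\<^sub>R (a', b')"
      "J (a', b') = Im c *\<^sub>R (a, b) + Re c *\<^sub>R (a', b')"
    using c unfolding complex_eigenvalue_def by (metis surj_pair)
  show ?thesis
  proof (cases "a = 0 \<and> a' = 0")
    case False
    define T where "T a = - H a + 2 *\<^sub>R (\<Sum>i\<in>UNIV. ip (v i) (H a) *\<^sub>R v i) - (\<mu> * mean a) *\<^sub>R e" for a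
    have T: "T a = Re c *\<^sub>R a - Im c *\<^sub>R a'" "T a' = Im c *\<^sub>R a + Re c *\<^sub>R a'"
      using J[THEN arg_cong[where f = fst]] by (simp_all add: fst_J T_def)
    have "(\<Sum>i\<in>UNIV. ip (v i) (H x) *\<^sub>R v i) \<in> S" for x
      using subspace_S v_in_S by (intro subspace_sum subspace_scale)
    then have mean_T: "mean (T x) = - \<mu> * mean x" for x
      by (simp add: T_def linear_diff[OF linear_mean] linear_add[OF linear_mean] linear_neg[OF linear_mean]
          linear_scale[OF linear_mean] mean_S H_in_S mean_e)
    have "ip x (0 *\<^sub>R x - H x + 2 *\<^sub>R (\<Sum>j\<in>UNIV. (\<alpha> j * ip (v j) x) *\<^sub>R v j)) < 0"
      if "x \<in> S" "x \<noteq> 0" for x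
      using neg that by (intro block_form_negative complement) auto
    then have "ip x (T x) < 0" if "x \<in> S" "x \<noteq> 0" for x
      using that by (simp add: T_def mean_S ip_v_H)
    then show ?thesis
      using complex_eigenvalue_block[OF linear_mean mean_eq_0 mean_T _ _ _ T] \<mu> False by simp
  next
    case True
    let ?I = "{i. b $ i \<noteq> 0 \<or> b' $ i \<noteq> 0}"
    define i where "i = Min ?I"
    have "?I \<noteq> {}" using nz True by (auto simp: vec_eq_iff zero_prod_def)
    then have i: "b $ i \<noteq> 0 \<or> b' $ i \<noteq> 0" using Min_in[of ?I] by (simp add: i_def)
    have before: "b $ j = 0" "b' $ j = 0" if "j < i" for j
    proof -
      have "j \<notin> ?I"
      proof
        assume "j \<in> ?I"
        then have "i \<le> j" unfolding i_def by (intro Min_le) auto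
        with that show False by simp
      qed
      then show "b $ j = 0" "b' $ j = 0" by auto
    qed
    \<comment> \<open>The diagonal block of row \<open>i\<close>; its own rank-one term is absorbed
      into the sum as the summand \<open>j = i\<close>.\<close>
    define T where "T x = \<alpha> i *\<^sub>R x - H (P x) + 2 *\<^sub>R (\<Sum>j | j \<le> i. (\<alpha> j * ip (v j) x) *\<^sub>R v j)" for x
    have le: "{j. j \<le> i} = insert i {j. j < i}" by auto
    have snd_J_T: "snd (J (0, y)) $ i = T (y $ i)" if "\<And>j. j < i \<Longrightarrow> y $ j = 0" for y
      unfolding snd_J T_def le using that
      by (simp add: ip.zero_left scaleR_add_right mult.assoc)
    have T: "T (b $ i) = Re c *\<^sub>R b $ i - Im c *\<^sub>R b' $ i"
      "T (b' $ i) = Im c *\<^sub>R b $ i + Re c *\<^sub>R b' $ i"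
      using J[THEN arg_cong[where f = "\<lambda>z. snd z $ i"]] True snd_J_T before by simp_all
    have "(\<Sum>j | j \<le> i. (\<alpha> j * ip (v j) x) *\<^sub>R v j) \<in> S" for x
      using subspace_S v_in_S by (intro subspace_sum subspace_scale)
    then have mean_T: "mean (T x) = \<alpha> i * mean x" for x
      by (simp add: T_def linear_diff[OF linear_mean] linear_add[OF linear_mean]
          linear_scale[OF linear_mean] mean_S H_in_S)
    have "\<alpha> i + \<alpha> j < 0" for j using neg[of i] neg[of j] by simp
    then have "ip x (T x) < 0" if "x \<in> S" "x \<noteq> 0" for x
      unfolding T_def P_on_S[OF that(1)] using less that
      by (intro block_form_negative complement less_imp_le[OF neg]) auto
    then show ?thesis
      using complex_eigenvalue_block[OF linear_mean mean_eq_0 mean_T neg _ i T] by blast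
  qed
qed

end

section \<open>The inner product induced by the weighted operator\<close>

locale weighted_operator =
  fixes w :: "real ^ 'n" and A :: "real ^ 'n \<Rightarrow> real ^ 'n"
  assumes w_pos: "0 < w $ i"
    and w_sum: "(\<Sum>i\<in>UNIV. w $ i) = 1"
    and A_linear: "linear A"
    and A_selfadjoint: "winner w (A x) y = winner w x (A y)"
    and A_psd: "0 \<le> winner w x (A x)"
    and A_ker: "{x. A x = 0} = span {1}"
begin

sublocale winner: bounded_bilinear "winner w"
  by (rule bounded_bilinear_winner)

lemma linear_wmean: "linear (wmean w)"
  unfolding wmean_def by (intro linearI) (simp_all add: winner.add_left winner.scaleR_left)

lemma wmean_1: "wmean w 1 = 1"
  by (simp add: wmean_def winner_def w_sum)

lemma wmean_eq_0: "wmean w x = 0 \<longleftrightarrow> x \<in> R0 w"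
  by (simp add: wmean_def R0_def winner_commute)

lemma subspace_R0: "subspace (R0 w)"
  by (simp add: subspace_def R0_def winner.zero_right winner.add_right winner.scaleR_right)

lemma dim_R0: "dim (R0 w) = CARD('n) - 1"
proof -
  have "R0 w = {x. w \<bullet> x = 0}"
    by (simp add: R0_def winner_def inner_vec_def)
  moreover have "w \<noteq> 0" using w_pos by (metis less_irrefl zero_index)
  ultimately show ?thesis by (simp add: dim_hyperplane)
qed

lemma linear_Ph: "linear (Ph w)"
  by (rule linearI)
    (simp_all add: Ph_def linear_add[OF linear_wmean] linear_scale[OF linear_wmean] algebra_simps)

lemma Ph_in_R0: "Ph w x \<in> R0 w"
  by (simp add: Ph_def wmean_eq_0[symmetric] linear_diff[OF linear_wmean] linear_scale[OF linear_wmean] wmean_1)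

lemma Ph_R0: "x \<in> R0 w \<Longrightarrow> Ph w x = x"
  by (simp add: Ph_def wmean_eq_0[symmetric])

lemma winner_Ph: "x \<in> R0 w \<Longrightarrow> winner w (Ph w y) x = winner w y x" "x \<in> R0 w \<Longrightarrow> winner w x (Ph w y) = winner w x y"
  by (simp_all add: R0_def Ph_def winner.diff_left winner.scaleR_left winner.diff_right winner.scaleR_right
      winner_commute[of _ x 1])

lemma A_1: "A 1 = 0"
  using A_ker span_base[of 1 "{1 :: real ^ 'n}"] by auto

lemma A_in_R0: "A x \<in> R0 w"
  using A_selfadjoint[of 1 x] by (simp add: R0_def A_1 winner.zero_left)

lemma A_Ph: "A (Ph w x) = A x"
  by (simp add: Ph_def linear_diff[OF A_linear] linear_scale[OF A_linear] A_1)

lemma A_eq_0: "x \<in> R0 w \<Longrightarrow> A x = 0 \<Longrightarrow> x = 0"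
proof -
  assume "x \<in> R0 w" "A x = 0"
  then have "wmean w x = 0" "x \<in> span {1}" using A_ker wmean_eq_0 by auto
  then obtain c where "x = c *\<^sub>R 1" by (auto simp: span_singleton)
  with \<open>wmean w x = 0\<close> show "x = 0"
    by (simp add: linear_scale[OF linear_wmean] wmean_1)
qed

text \<open>The kernel of \<open>A\<close> is spanned by 1 and meets \<open>R0 w\<close> only in 0;
  injectivity and equality of dimensions give surjectivity.\<close>

lemma bij_A: "bij_betw A (R0 w) (R0 w)"
proof -
  have inj: "inj_on A (R0 w)"
    using A_eq_0 by (simp add: linear_inj_on_iff_eq_0[OF A_linear subspace_R0])
  have "dim (A ` R0 w) = dim (R0 w)"
    using dim_image_eq[OF A_linear, of "R0 w"] inj span_eq_iff[THEN iffD2, OF subspace_R0] by simp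
  then have "A ` R0 w = R0 w"
    using subspace_dim_equal[OF linear_subspace_image[OF A_linear subspace_R0] subspace_R0] A_in_R0 by auto
  with inj show ?thesis by (simp add: bij_betw_def)
qed

lemma A0_inv_in_R0: "x \<in> R0 w \<Longrightarrow> A0_inv w A x \<in> R0 w"
  and A_A0_inv: "x \<in> R0 w \<Longrightarrow> A (A0_inv w A x) = x"
  and A0_inv_A: "x \<in> R0 w \<Longrightarrow> A0_inv w A (A x) = x"
  using bij_A unfolding A0_inv_def bij_betw_def
  by (auto intro: the_inv_into_into f_the_inv_into_f the_inv_into_f_f)

lemma A0_inv_A_Ph: "A0_inv w A (A x) = Ph w x"
  using A0_inv_A[OF Ph_in_R0] by (simp add: A_Ph)

text \<open>A globally defined extension of \<open>Ainner\<close>, which is only meaningful on \<open>R0 w\<close>.\<close>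

definition ip :: "real ^ 'n \<Rightarrow> real ^ 'n \<Rightarrow> real" where
  "ip x y = winner w (Ph w x) (A0_inv w A (Ph w y))"

lemma ip_eq_Ainner: "x \<in> R0 w \<Longrightarrow> y \<in> R0 w \<Longrightarrow> ip x y = Ainner w A x y"
  by (simp add: ip_def Ainner_def Ph_R0)

text \<open>The inverse cancels against \<open>A\<close> up to the projection. This carries
  self-adjointness of the Hessian over from the weighted product.\<close>

lemma ip_A: "ip x (A y) = winner w (Ph w x) y"
  by (simp add: ip_def Ph_R0 A_in_R0 A0_inv_A_Ph winner_Ph Ph_in_R0)

text \<open>\<open>A0_inv w A y\<close> has mean zero, so projecting \<open>x\<close> changes
  nothing. The vector field can thus be written, and differentiated, through the bilinear
  \<open>ip\<close> even for \<open>x\<close> outside \<open>R0 w\<close>.\<close>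

lemma rank1_eq: "y \<in> R0 w \<Longrightarrow> rank1 w A x y = ip x y *\<^sub>R x"
  by (simp add: rank1_def ip_def Ph_R0 A0_inv_in_R0 winner_Ph)

lemma ip_Ph: "ip x (Ph w y) = ip x y"
  by (simp add: ip_def Ph_R0 Ph_in_R0)

lemma inner_on_subspace_ip: "inner_on_subspace ip (R0 w)"
proof -
  define B where "B y = A0_inv w A (Ph w y)" for y
  have AB: "A (B y) = Ph w y" for y by (simp add: B_def A_A0_inv Ph_in_R0)
  have B: "B y \<in> R0 w" for y by (simp add: B_def A0_inv_in_R0 Ph_in_R0)
  \<comment> \<open>\<open>B\<close> is known only as an inverse, so its linearity is checked after
    applying \<open>A\<close>.\<close>
  have eq: "a = b" if "a \<in> R0 w" "b \<in> R0 w" "A a = A b" for a b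
    using that bij_A by (auto simp: bij_betw_def dest: inj_onD)
  have lin: "linear B"
  proof (rule linearI)
    fix x y and r :: real
    show "B (x + y) = B x + B y"
      by (rule eq[OF B subspace_add[OF subspace_R0 B B]])
        (simp add: AB linear_add[OF A_linear] linear_add[OF linear_Ph])
    show "B (r *\<^sub>R y) = r *\<^sub>R B y"
      by (rule eq[OF B subspace_scale[OF subspace_R0 B]])
        (simp add: AB linear_scale[OF A_linear] linear_scale[OF linear_Ph])
  qed
  have "bilinear ip"
    unfolding bilinear_def ip_def B_def[symmetric]
    by (intro conjI allI linearI)
      (simp_all add: linear_add[OF lin] linear_scale[OF lin] linear_add[OF linear_Ph] linear_scale[OF linear_Ph]
        winner.add_left winner.add_right winner.scaleR_left winner.scaleR_right)
  then have "bounded_bilinear ip" by (simp add: bilinear_conv_bounded_bilinear)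
  moreover have "ip x y = ip y x" for x y
  proof -
    define a b where "a = A0_inv w A (Ph w x)" and "b = A0_inv w A (Ph w y)"
    have "Ph w x = A a" "Ph w y = A b" by (simp_all add: a_def b_def A_A0_inv Ph_in_R0)
    then show ?thesis
      unfolding ip_def a_def[symmetric] b_def[symmetric]
      using A_selfadjoint[of a b] winner_commute by metis
  qed
  moreover have "0 < ip x x" if x: "x \<in> R0 w" "x \<noteq> 0" for x
  proof (rule ccontr)
    define a where "a = A0_inv w A x"
    have a: "A a = x" "ip x x = winner w a (A a)"
      using x(1) by (simp_all add: a_def A_A0_inv ip_def Ph_R0 A_selfadjoint winner_commute)
    assume "\<not> 0 < ip x x"
    \<comment> \<open>A null vector of the semidefinite form of \<open>A\<close> lies in its
      radical; pairing with \<open>A x\<close> then yields \<open>winner w x x = 0\<close>.\<close>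
    then have zero: "winner w a (A a) = 0" using A_psd[of a] a by simp
    have "bilinear (\<lambda>a b. winner w a (A b))"
      unfolding bilinear_def
      by (intro conjI allI linearI) (simp_all add: linear_add[OF A_linear] linear_scale[OF A_linear]
        winner.add_left winner.add_right winner.scaleR_left winner.scaleR_right)
    from semidefinite_form_zero[OF subspace_UNIV this _ _ UNIV_I zero UNIV_I]
    have "winner w a (A y) = 0" for y
      using A_selfadjoint A_psd winner_commute by metis
    then have "winner w x x = 0" using a(1) A_selfadjoint[of a x] by simp
    then show False using winner_pos_def(2)[OF w_pos] x(2) by blast
  qed
  ultimately show ?thesis
    by (simp add: inner_on_subspace_def inner_on_subspace_axioms_def subspace_R0)
qed

sublocale inner_on_subspace ip "R0 w"
  by (rule inner_on_subspace_ip)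

lemma selfadjoint_Ahess:
  assumes "C_class 3 F"
  shows "selfadjoint_on_subspace ip (R0 w) (Ahess w A F u)"
proof (intro selfadjoint_on_subspace.intro selfadjoint_on_subspace_axioms.intro inner_on_subspace_ip)
  show "linear (Ahess w A F u)"
    unfolding Ahess_def[abs_def]
    using linear_compose[OF whess_linear[OF w_pos assms] A_linear] by (simp add: o_def)
  show "Ahess w A F u x \<in> R0 w" for x by (simp add: Ahess_def A_in_R0)
  show "ip (Ahess w A F u x) y = ip x (Ahess w A F u y)" if "x \<in> R0 w" "y \<in> R0 w" for x y
    unfolding ip_sym[of _ y] using that whess_selfadjoint[OF w_pos assms, of u x y]
    by (simp add: Ahess_def ip_A Ph_R0 winner_commute)
qed

end

section \<open>Multiplicities and enumeration of eigenvalues\<close>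

context selfadjoint_on_subspace
begin

text \<open>Generalized eigenvectors are eigenvectors, so algebraic and geometric multiplicities
  coincide.\<close>

lemma eigen_mult_on_eq: "eigen_mult_on S H l = dim {x \<in> S. H x = l *\<^sub>R x}"
proof -
  have "(\<exists>p. ((\<lambda>y. H y - l *\<^sub>R y) ^^ p) x = 0) \<longleftrightarrow> H x = l *\<^sub>R x" if "x \<in> S" for x
  proof
    assume "H x = l *\<^sub>R x"
    then have "((\<lambda>y. H y - l *\<^sub>R y) ^^ 1) x = 0" by simp
    then show "\<exists>p. ((\<lambda>y. H y - l *\<^sub>R y) ^^ p) x = 0" ..
  qed (use generalized_eigenvector_imp_eigenvector[OF that] in blast)
  then show ?thesis unfolding eigen_mult_on_def by (intro arg_cong[where f = dim]) auto
qed

lemma eigenvalue_on_iff_mult: "eigenvalue_on S H l \<longleftrightarrow> eigen_mult_on S H l \<noteq> 0"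
  by (auto simp: eigen_mult_on_eq dim_eq_0 eigenvalue_on_def eigenvector_on_def)

text \<open>Uniqueness up to a scalar confines the eigenspace to the line through \<open>x\<close>,
  which amounts to dimension 1.\<close>

lemma the_eigenvector_on_iff_simple:
  "the_eigenvector_on S H l x \<longleftrightarrow> eigenvector_on S H l x \<and> eigen_mult_on S H l = 1"
proof (cases "eigenvector_on S H l x")
  case True
  let ?E = "{x \<in> S. H x = l *\<^sub>R x}"
  have x: "x \<in> ?E" "x \<noteq> 0" using True by (auto simp: eigenvector_on_def)
  have sub: "subspace ?E"
    using subspace_S unfolding subspace_def
    by (auto simp: linear_0[OF linear_H] linear_add[OF linear_H] linear_scale[OF linear_H] algebra_simps)
  have span: "span {x} \<subseteq> ?E" using x sub by (intro span_minimal) auto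
  have dim1: "dim (span {x}) = 1" using x(2) by simp
  have "(\<forall>y. eigenvector_on S H l y \<longrightarrow> (\<exists>c. y = c *\<^sub>R x)) \<longleftrightarrow> ?E \<subseteq> span {x}"
  proof
    assume unique: "\<forall>y. eigenvector_on S H l y \<longrightarrow> (\<exists>c. y = c *\<^sub>R x)"
    show "?E \<subseteq> span {x}"
    proof
      fix y assume "y \<in> ?E"
      then show "y \<in> span {x}"
        using unique by (cases "y = 0") (auto simp: eigenvector_on_def span_singleton span_0)
    qed
  next
    assume "?E \<subseteq> span {x}"
    then show "\<forall>y. eigenvector_on S H l y \<longrightarrow> (\<exists>c. y = c *\<^sub>R x)"
      unfolding eigenvector_on_def span_singleton by blast
  qed
  also have "\<dots> \<longleftrightarrow> dim ?E = 1"
  proof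
    assume "?E \<subseteq> span {x}"
    then have "?E = span {x}" using span by (rule subset_antisym)
    then show "dim ?E = 1" using dim1 by simp
  next
    assume "dim ?E = 1"
    then have "span {x} = ?E" using dim1 by (intro subspace_dim_equal subspace_span sub span) simp
    then show "?E \<subseteq> span {x}" by simp
  qed
  finally show ?thesis using True by (simp add: the_eigenvector_on_def eigen_mult_on_eq)
qed (simp add: the_eigenvector_on_def)

lemma eigenvalue_iff_in_list:
  assumes "eigenvalue_list_on S H lam"
  shows "eigenvalue_on S H l \<longleftrightarrow> l \<in> lam ` {1..dim S}"
proof -
  have "eigen_mult_on S H l = card {i \<in> {1..dim S}. lam i = l}"
    using assms by (simp add: eigenvalue_list_on_def)
  then show ?thesis unfolding eigenvalue_on_iff_mult by auto
qed

text \<open>The negative positions are grouped by value; each fibre has the size of a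
  multiplicity.\<close>

lemma num_neg_eigenvalues_on_eq:
  assumes "eigenvalue_list_on S H lam"
  shows "num_neg_eigenvalues_on S H = card {i \<in> {1..dim S}. lam i < 0}"
proof -
  let ?N = "{i \<in> {1..dim S}. lam i < 0}"
  have "card ?N = (\<Sum>l\<in>lam ` ?N. card {i \<in> ?N. lam i = l})"
    using sum.image_gen[of ?N "\<lambda>_. 1::nat" lam] by simp
  also have "\<dots> = (\<Sum>l\<in>lam ` ?N. eigen_mult_on S H l)"
  proof (rule sum.cong[OF refl])
    fix l assume "l \<in> lam ` ?N"
    then have "{i \<in> ?N. lam i = l} = {i \<in> {1..dim S}. lam i = l}" by auto
    then show "card {i \<in> ?N. lam i = l} = eigen_mult_on S H l"
      using assms by (simp add: eigenvalue_list_on_def)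
  qed
  also have "lam ` ?N = {l. eigenvalue_on S H l \<and> l < 0}"
    using eigenvalue_iff_in_list[OF assms] by auto
  finally show ?thesis by (simp add: num_neg_eigenvalues_on_def)
qed

end

section \<open>Ranks in a finite linear order and sorted lists of values\<close>

lemma pos_less: "i < j \<Longrightarrow> pos i < pos j"
proof -
  assume "i < j"
  then have "{l. l \<le> i} \<subseteq> {l. l \<le> j}" "j \<in> {l. l \<le> j} - {l. l \<le> i}" by auto
  then have "{l. l \<le> i} \<subset> {l. l \<le> j}" by blast
  then show ?thesis unfolding pos_def by (intro psubset_card_mono) auto
qed

lemma pos_inj: "inj pos"
  using pos_less by (metis injI linorder_less_linear less_irrefl)

lemma range_pos: "range (pos :: 'k::{finite,linorder} \<Rightarrow> nat) = {1..CARD('k)}"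
proof (rule card_subset_eq)
  have "1 \<le> pos i" "pos i \<le> CARD('k)" for i :: 'k
    using card_mono[of "{j. j \<le> i}" "{i}"] card_mono[of UNIV "{j. j \<le> i}"] by (auto simp: pos_def)
  then show "range (pos :: 'k \<Rightarrow> nat) \<subseteq> {1..CARD('k)}" by auto
  show "card (range (pos :: 'k \<Rightarrow> nat)) = card {1..CARD('k)}"
    using card_image[OF pos_inj[where 'a = 'k]] by simp
qed simp

text \<open>\<open>a\<close> has as many distinct values as \<open>lam\<close> has positions, so
  both have the same range and \<open>lam\<close> is strictly increasing. The position of a value is
  then the number of values not exceeding it.\<close>

lemma sorted_enumeration_pos:
  fixes a :: "'k::{finite,linorder} \<Rightarrow> real"
  assumes a: "\<And>i j. i < j \<Longrightarrow> a i < a j"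
    and lam: "mono_on {1..CARD('k)} lam" "range a \<subseteq> lam ` {1..CARD('k)}"
  shows "lam (pos i) = a i" and "inj_on lam {1..CARD('k)}"
proof -
  let ?K = "{1..CARD('k)}"
  have inj_a: "inj a" using a by (metis injI linorder_less_linear less_irrefl)
  have range: "range a = lam ` ?K"
  proof (rule card_subset_eq[OF _ lam(2)])
    have "card (lam ` ?K) \<le> card ?K" by (rule card_image_le) simp
    moreover have "card (range a) \<le> card (lam ` ?K)" by (rule card_mono) (use lam(2) in auto)
    ultimately show "card (range a) = card (lam ` ?K)" using card_image[OF inj_a] by simp
  qed simp
  then have "card (lam ` ?K) = card ?K" using card_image[OF inj_a] by simp
  then show inj: "inj_on lam ?K" by (intro eq_card_imp_inj_on) auto
  have mono: "lam p \<le> lam q \<longleftrightarrow> p \<le> q" if "p \<in> ?K" "q \<in> ?K" for p q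
    using that mono_onD[OF lam(1), of p q] mono_onD[OF lam(1), of q p] inj_onD[OF inj, of p q]
    by (metis antisym nle_le)
  have le: "a j \<le> a i \<longleftrightarrow> j \<le> i" for i j using a by (metis leD linorder_le_less_linear order_le_less)
  obtain p where p: "p \<in> ?K" "lam p = a i" using range by (metis imageE rangeI)
  have "lam ` {q \<in> ?K. lam q \<le> lam p} = {x \<in> lam ` ?K. x \<le> lam p}" by auto
  also have "\<dots> = a ` {j. j \<le> i}" unfolding range[symmetric] p(2) using le by auto
  finally have "card (lam ` {q \<in> ?K. lam q \<le> lam p}) = card (a ` {j. j \<le> i})" by simp
  moreover have "card (a ` {j. j \<le> i}) = pos i"
    unfolding pos_def using inj_a by (intro card_image) (rule inj_on_subset[OF _ subset_UNIV])
  moreover have "{q \<in> ?K. lam q \<le> lam p} = {1..p}" using mono[OF _ p(1)] p(1) by auto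
  moreover have "card (lam ` {1..p}) = p"
    using card_image[OF inj_on_subset[OF inj, of "{1..p}"]] p(1) by simp
  ultimately show "lam (pos i) = a i" using p(2) by simp
qed

section \<open>Linearization of the saddle dynamics\<close>

text \<open>Expanding the second argument in a basis reduces joint differentiability to the product
  rule. \<open>E z a\<close> is the derivative of \<open>D\<close> in the direction
  \<open>a\<close>, applied to \<open>z\<close>.\<close>

lemma has_derivative_linear_in_second:
  fixes D :: "'a::real_normed_vector \<Rightarrow> 'b::euclidean_space \<Rightarrow> 'c::real_normed_vector"
  assumes lin: "\<And>x. linear (D x)" and diff: "\<And>h. (\<lambda>x. D x h) differentiable (at u)"
  obtains E where "\<And>z. linear (E z)"
    "\<And>z. ((\<lambda>p. D (fst p) (snd p)) has_derivative (\<lambda>d. E z (fst d) + D u (snd d))) (at (u, z))"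
proof -
  define D' where "D' b = frechet_derivative (\<lambda>x. D x b) (at u)" for b
  have D': "((\<lambda>x. D x b) has_derivative D' b) (at u)" for b
    using diff by (simp add: D'_def frechet_derivative_works[symmetric])
  have expand: "D x y = (\<Sum>b\<in>Basis. (y \<bullet> b) *\<^sub>R D x b)" for x y
    by (subst euclidean_representation[of y, symmetric])
      (simp add: linear_sum[OF lin] linear_scale[OF lin])
  have D'_fst: "((\<lambda>p. D (fst p) b) has_derivative (\<lambda>d. D' b (fst d))) (at (u, z))" for b z
    by (rule has_derivative_compose[where f = fst and f' = fst and g = "\<lambda>x. D x b"])
      (auto intro: D' has_derivative_fst has_derivative_ident)
  have snd: "((\<lambda>p. snd p \<bullet> b) has_derivative (\<lambda>d. snd d \<bullet> b)) (at p)" for b :: 'b and p :: "'a \<times> 'b"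
    by (intro has_derivative_inner_left has_derivative_snd has_derivative_ident)
  define E where "E z a = (\<Sum>b\<in>Basis. (z \<bullet> b) *\<^sub>R D' b a)" for z a
  show ?thesis
  proof
    show "linear (E z)" for z
      unfolding E_def using has_derivative_linear[OF D']
      by (intro linear_compose_sum ballI linear_compose_scale_right)
    show "((\<lambda>p. D (fst p) (snd p)) has_derivative (\<lambda>d. E z (fst d) + D u (snd d))) (at (u, z))" for z
    proof -
      have "((\<lambda>p. \<Sum>b\<in>Basis. (snd p \<bullet> b) *\<^sub>R D (fst p) b) has_derivative
          (\<lambda>d. \<Sum>b\<in>Basis. (snd (u, z) \<bullet> b) *\<^sub>R D' b (fst d) + (snd d \<bullet> b) *\<^sub>R D (fst (u, z)) b)) (at (u, z))"
        by (intro has_derivative_sum has_derivative_scaleR snd D'_fst)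
      then show ?thesis by (simp add: expand[symmetric] E_def sum.distrib)
    qed
  qed
qed

context weighted_operator
begin

lemma saddle_field_eq:
  "saddle_field w A F \<mu> m = (\<lambda>z.
    (- (Agrad w A F (fst z) - 2 *\<^sub>R (\<Sum>i\<in>UNIV. ip (snd z $ i) (Agrad w A F (fst z)) *\<^sub>R snd z $ i))
       - (\<mu> * (wmean w (fst z) - m)) *\<^sub>R 1,
     \<chi> i. let h = Ahess w A F (fst z) (Ph w (snd z $ i)) in
       - (h - ip (snd z $ i) h *\<^sub>R snd z $ i - 2 *\<^sub>R (\<Sum>j | j < i. ip (snd z $ j) h *\<^sub>R snd z $ j))))"
  by (simp add: saddle_field_def rank1_eq Agrad_def Ahess_def A_in_R0 Let_def case_prod_beta')

lemma linear_Ahess: "C_class 3 F \<Longrightarrow> linear (Ahess w A F u)"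
  using selfadjoint_Ahess by (simp add: selfadjoint_on_subspace_def selfadjoint_on_subspace_axioms_def)

lemma Agrad_has_derivative: "C_class 3 F \<Longrightarrow> (Agrad w A F has_derivative Ahess w A F u) (at u)"
  unfolding Agrad_def[abs_def] Ahess_def[abs_def]
  using bounded_linear.has_derivative[OF _ wgrad_has_derivative[OF w_pos]] A_linear
  by (simp add: linear_conv_bounded_linear)

lemma Ahess_differentiable: "C_class 3 F \<Longrightarrow> (\<lambda>u. Ahess w A F u h) differentiable (at u)"
  unfolding Ahess_def
  using whess_differentiable[OF w_pos] A_linear
  by (metis linear_imp_differentiable differentiable_compose)

lemma saddle_field_linearization:
  fixes v :: "real ^ 'n ^ 'k::{finite,linorder}"
  assumes C3: "C_class 3 F" and G0: "Agrad w A F u = 0"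
    and frame: "eigenframe ip (R0 w) (Ahess w A F u) (($) v) \<alpha>"
  obtains E where
    "saddle_linearization ip (R0 w) (Ahess w A F u) (($) v) \<alpha> (wmean w) (Ph w) 1 E"
    "(saddle_field w A F \<mu> m has_derivative
       saddle_linearization.J ip (Ahess w A F u) (($) v) \<alpha> (wmean w) (Ph w) 1 E \<mu>) (at (u, v))"
proof -
  interpret eigenframe ip "R0 w" "Ahess w A F u" "($) v" \<alpha> by (rule frame)
  obtain E' where E': "\<And>z. linear (E' z)"
    "\<And>z. ((\<lambda>p. Ahess w A F (fst p) (snd p)) has_derivative (\<lambda>d. E' z (fst d) + Ahess w A F u (snd d))) (at (u, z))"
    using has_derivative_linear_in_second[OF linear_Ahess[OF C3] Ahess_differentiable[OF C3]] by blast
  define E where "E i = E' (v $ i)" for i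
  interpret L: saddle_linearization ip "R0 w" "Ahess w A F u" "($) v" \<alpha> "wmean w" "Ph w" 1 E \<mu>
    by (intro saddle_linearization.intro saddle_linearization_axioms.intro frame)
      (simp_all add: linear_wmean wmean_eq_0 wmean_1 ip_Ph E_def linear_0[OF E'(1)], simp add: Ph_def)
  let ?z = "(u, v)"
  define G K where "G z = Agrad w A F (fst z)" and "K i z = Ahess w A F (fst z) (Ph w (snd z $ i))"
    for z :: "(real ^ 'n) \<times> (real ^ 'n ^ 'k::{finite,linorder})" and i
  have "bounded_linear (Ph w)" using linear_Ph by (simp add: linear_conv_bounded_linear)
  then have PV: "((\<lambda>z. (fst z, Ph w (snd z $ i))) has_derivative (\<lambda>d. (fst d, Ph w (snd d $ i)))) (at ?z)" for i
    by (intro has_derivative_Pair has_derivative_fst has_derivative_ident bounded_linear.has_derivative[of "Ph w"]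
        bounded_linear.has_derivative[OF bounded_linear_vec_nth] has_derivative_snd)
  have V: "((\<lambda>z. snd z $ i) has_derivative (\<lambda>d. snd d $ i)) (at ?z)" for i
    by (intro bounded_linear.has_derivative[OF bounded_linear_vec_nth] has_derivative_snd has_derivative_ident)
  have G: "(G has_derivative (\<lambda>d. Ahess w A F u (fst d))) (at ?z)"
    unfolding G_def
    by (rule has_derivative_compose[where f = fst and f' = fst])
      (auto intro: has_derivative_fst has_derivative_ident Agrad_has_derivative[OF C3])
  have K: "(K i has_derivative (\<lambda>d. E i (fst d) + Ahess w A F u (Ph w (snd d $ i)))) (at ?z)" for i
  proof -
    have "((\<lambda>p. Ahess w A F (fst p) (snd p)) has_derivative (\<lambda>d. E i (fst d) + Ahess w A F u (snd d)))
        (at (fst ?z, Ph w (snd ?z $ i)))"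
      using E'(2)[of "v $ i"] by (simp add: E_def Ph_R0 v_in_S)
    from has_derivative_compose[OF PV this] show ?thesis by (simp add: K_def[abs_def])
  qed
  have rank: "((\<lambda>z. ip (snd z $ j) (Y z) *\<^sub>R snd z $ j) has_derivative
      (\<lambda>d. ip (v $ j) (Y ?z) *\<^sub>R snd d $ j + (ip (v $ j) (Y' d) + ip (snd d $ j) (Y ?z)) *\<^sub>R v $ j)) (at ?z)"
    if "(Y has_derivative Y') (at ?z)" for Y Y' j
    using has_derivative_scaleR[OF ip.FDERIV[OF V that] V, of j j] by simp
  have wm: "((\<lambda>z. wmean w (fst z)) has_derivative (\<lambda>d. wmean w (fst d))) (at ?z)"
    using linear_wmean
    by (intro bounded_linear.has_derivative[of "wmean w"] has_derivative_fst has_derivative_ident)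
      (simp add: linear_conv_bounded_linear)
  have K_at: "K i ?z = \<alpha> i *\<^sub>R v $ i" for i
    by (simp add: K_def Ph_R0 v_in_S eigen)
  have G_at: "G ?z = 0" by (simp add: G_def G0)
  have 1: "((\<lambda>z. - (G z - 2 *\<^sub>R (\<Sum>i\<in>UNIV. ip (snd z $ i) (G z) *\<^sub>R snd z $ i))
       - (\<mu> * (wmean w (fst z) - m)) *\<^sub>R 1) has_derivative (\<lambda>d. fst (L.J d))) (at ?z)"
    by (rule has_derivative_eq_rhs,
        (rule has_derivative_diff has_derivative_minus has_derivative_scaleR_right has_derivative_sum
          G rank[OF G] has_derivative_scaleR_left has_derivative_mult_right wm has_derivative_const)+,
        simp add: L.J_def case_prod_beta' G_at ip.zero_right)
  have 2: "((\<lambda>z. - (K i z - ip (snd z $ i) (K i z) *\<^sub>R snd z $ i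
       - 2 *\<^sub>R (\<Sum>j | j < i. ip (snd z $ j) (K i z) *\<^sub>R snd z $ j))) has_derivative (\<lambda>d. snd (L.J d) $ i)) (at ?z)" for i
    by (rule has_derivative_eq_rhs,
        (rule has_derivative_diff has_derivative_minus has_derivative_scaleR_right has_derivative_sum
          K rank[OF K])+,
        simp add: L.J_def case_prod_beta' K_at ip.scaleR_right orthonormal less_imp_neq Let_def
          cong: sum.cong_simp)
  have "(saddle_field w A F \<mu> m has_derivative (\<lambda>d. (fst (L.J d), \<chi> i. snd (L.J d) $ i))) (at ?z)"
    unfolding saddle_field_eq Let_def
    using 1 2 unfolding G_def K_def by (intro has_derivative_Pair has_derivative_vec_lambda)
  then have "(saddle_field w A F \<mu> m has_derivative L.J) (at ?z)"
    by simp
  with L.saddle_linearization_axioms show ?thesis by (rule that)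
qed

end

section \<open>Linear stability against the saddle property with its simple eigenvectors\<close>

theorem theorem4:
  fixes w :: "real ^ 'n"
    and A :: "real ^ 'n \<Rightarrow> real ^ 'n"
    and F :: "real ^ 'n \<Rightarrow> real"
    and m \<mu> :: real
    and k :: nat
    and u :: "real ^ 'n"
    and v :: "real ^ 'n ^ 'k::{finite,linorder}"
    and lam :: "nat \<Rightarrow> real"
  assumes w_pos: "\<And>i. 0 < w $ i"
    and w_sum: "(\<Sum>i\<in>UNIV. w $ i) = 1"
    and A_linear: "linear A"
    and A_selfadjoint: "\<And>x y. winner w (A x) y = winner w x (A y)"
    and A_psd: "\<And>x. 0 \<le> winner w x (A x)"
    and A_ker: "{x. A x = 0} = span {1}"
    and k_card: "CARD('k) = k"
    and k_ge: "1 \<le> k"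
    and k_le: "k \<le> CARD('n) - 1"
    and \<mu>_pos: "0 < \<mu>"
    and F_C3: "C_class 3 F"
    and u_mean: "wmean w u = m"
    and v_R0: "\<And>i. v $ i \<in> R0 w"
    and v_unit: "\<And>i. Ainner w A (v $ i) (v $ i) = 1"
    and nondegenerate: "bij_betw (Ahess w A F u) (R0 w) (R0 w)"
    and eigenvalues: "eigenvalue_list_on (R0 w) (Ahess w A F u) lam"
    and lam_neg: "\<And>i. i \<in> {1..k} \<Longrightarrow> lam i < 0"
    and lam_pos: "\<And>i. i \<in> {k+1..CARD('n) - 1} \<Longrightarrow> 0 < lam i"
  shows "linearly_stable_steady_state (saddle_field w A F \<mu> m) (u, v) \<longleftrightarrow>
         index_saddle w A F k u \<and>
         (\<forall>i. the_eigenvector_on (R0 w) (Ahess w A F u) (lam (pos i)) (v $ i))"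
proof -
  interpret weighted_operator w A
    by unfold_locales (fact w_pos w_sum A_selfadjoint A_psd A_ker
      A_linear[unfolded linear_iff, THEN conjunct1, rule_format] A_linear[unfolded linear_iff, THEN conjunct2, rule_format])+
  let ?H = "Ahess w A F u"
  interpret H: selfadjoint_on_subspace ip "R0 w" ?H
    by (rule selfadjoint_Ahess[OF F_C3])
  have v_ip: "ip (v $ i) (v $ i) = 1" for i
    using v_unit v_R0 by (simp add: ip_eq_Ainner)
  have v_nonzero: "v $ i \<noteq> 0" for i
    using v_ip[of i] by (auto simp: ip.zero_left)
  have H_inj: "x = 0" if "x \<in> R0 w" "?H x = 0" for x
    using inj_onD[OF bij_betw_imp_inj_on[OF nondegenerate], of x 0] that
    by (simp add: subspace_0[OF subspace_R0] linear_0[OF H.linear_H])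
  have mono: "mono_on {1..CARD('n) - 1} lam"
    using eigenvalues by (simp add: eigenvalue_list_on_def dim_R0)
  have mult: "eigen_mult_on (R0 w) ?H l = card {i \<in> {1..CARD('n) - 1}. lam i = l}" for l
    using eigenvalues by (simp add: eigenvalue_list_on_def dim_R0)
  have neg_iff: "lam i < 0 \<longleftrightarrow> i \<le> k" if "i \<in> {1..CARD('n) - 1}" for i
    using lam_neg[of i] lam_pos[of i] that by (cases "i \<le> k") auto
  have neg_eigenvalue: "l \<in> lam ` {1..k}" if "x \<in> R0 w" "x \<noteq> 0" "?H x = l *\<^sub>R x" "l < 0" for x l
  proof -
    have "eigenvalue_on (R0 w) ?H l"
      using that by (auto simp: eigenvalue_on_def eigenvector_on_def)
    then show ?thesis
      using H.eigenvalue_iff_in_list[OF eigenvalues] neg_iff \<open>l < 0\<close> by (auto simp: dim_R0)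
  qed
  show ?thesis
  proof
    assume "linearly_stable_steady_state (saddle_field w A F \<mu> m) (u, v)"
    then obtain J where zero: "saddle_field w A F \<mu> m (u, v) = 0"
      and J: "(saddle_field w A F \<mu> m has_derivative J) (at (u, v))"
      and stable: "\<And>c. complex_eigenvalue J c \<Longrightarrow> Re c < 0"
      unfolding linearly_stable_steady_state_def by blast
    define \<alpha> where "\<alpha> i = ip (v $ i) (?H (v $ i))" for i
    have "snd (saddle_field w A F \<mu> m (u, v)) $ i = 0" for i using zero by simp
    then have "?H (v $ i) = ip (v $ i) (?H (v $ i)) *\<^sub>R v $ i
        + 2 *\<^sub>R (\<Sum>j | j < i. ip (v $ j) (?H (v $ i)) *\<^sub>R v $ j)" for i
      by (simp add: saddle_field_eq Ph_R0 v_R0 Let_def algebra_simps)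
    from H.stationary_directions[where v = "($) v", OF H_inj v_R0 v_ip this]
    have Hv: "?H (v $ i) = \<alpha> i *\<^sub>R v $ i" and orth: "j < i \<Longrightarrow> ip (v $ j) (v $ i) = 0" for i j
      unfolding \<alpha>_def by blast+
    have frame: "eigenframe ip (R0 w) ?H (($) v) \<alpha>"
    proof
      show "ip (v $ i) (v $ j) = (if i = j then 1 else 0)" for i j
        using orth[of i j] orth[of j i] ip_sym v_ip by (cases i j rule: linorder_cases) auto
    qed (simp_all add: v_R0 Hv)
    then interpret frame: eigenframe ip "R0 w" ?H "($) v" \<alpha> .
    have G0: "Agrad w A F u = 0"
    proof -
      have "fst (saddle_field w A F \<mu> m (u, v)) = 0" using zero by simp
      then have G: "Agrad w A F u = 2 *\<^sub>R (\<Sum>i\<in>UNIV. ip (v $ i) (Agrad w A F u) *\<^sub>R v $ i)"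
        by (simp add: saddle_field_eq u_mean)
      \<comment> \<open>The gradient is twice its own projection onto the frame, so each coefficient
        equals its double and vanishes.\<close>
      have "ip (v $ j) (Agrad w A F u) = 2 * ip (v $ j) (Agrad w A F u)" for j
        by (subst G) (simp only: ip.scaleR_right frame.ip_sum_frame real_scaleR_def)
      then have "ip (v $ j) (Agrad w A F u) = 0" for j using mult_cancel_right1 by fastforce
      then show ?thesis by (subst G) simp
    qed
    obtain E where "saddle_linearization ip (R0 w) ?H (($) v) \<alpha> (wmean w) (Ph w) 1 E"
      and J': "(saddle_field w A F \<mu> m has_derivative
        saddle_linearization.J ip ?H (($) v) \<alpha> (wmean w) (Ph w) 1 E \<mu>) (at (u, v))"
      using saddle_field_linearization[OF F_C3 G0 frame] .
    then interpret L: saddle_linearization ip "R0 w" ?H "($) v" \<alpha> "wmean w" "Ph w" 1 E \<mu> by simp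
    have stable': "complex_eigenvalue (L.J) c \<Longrightarrow> Re c < 0" for c
      using stable has_derivative_unique[OF J J'] by simp
    have \<alpha>_neg: "\<alpha> i < 0" and \<alpha>_less: "i < j \<Longrightarrow> \<alpha> i < \<alpha> j" for i j
      using L.stable_imp_alpha_neg[OF stable'] L.stable_imp_alpha_less[OF stable'] by blast+
    have "mono_on {1..CARD('k)} lam"
      using mono k_le k_card by (auto intro: mono_on_subset)
    moreover have "range \<alpha> \<subseteq> lam ` {1..CARD('k)}"
      using neg_eigenvalue[OF v_R0 v_nonzero Hv \<alpha>_neg] k_card by auto
    ultimately have lam_\<alpha>: "lam (pos i) = \<alpha> i" and inj: "inj_on lam {1..k}" for i
      using sorted_enumeration_pos[of \<alpha> lam, OF \<alpha>_less] k_card by auto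
    have "index_saddle w A F k u"
    proof -
      have "{i \<in> {1..CARD('n) - 1}. lam i < 0} = {1..k}" using neg_iff k_le by auto
      then show ?thesis
        unfolding index_saddle_def using G0 nondegenerate H.num_neg_eigenvalues_on_eq[OF eigenvalues]
        by (simp add: dim_R0)
    qed
    moreover have "the_eigenvector_on (R0 w) ?H (lam (pos i)) (v $ i)" for i
    proof -
      have p: "pos i \<in> {1..k}" using range_pos[where 'k = 'k] k_card by auto
      \<comment> \<open>Another position with the same value would also be negative, hence at most
        \<open>k\<close>, where \<open>lam\<close> is injective.\<close>
      have "{j \<in> {1..CARD('n) - 1}. lam j = lam (pos i)} = {pos i}"
        using p neg_iff[of "pos i"] neg_iff k_le inj_onD[OF inj _ _ p] by fastforce
      then have "eigen_mult_on (R0 w) ?H (lam (pos i)) = 1" by (simp add: mult)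
      then show ?thesis
        unfolding H.the_eigenvector_on_iff_simple
        using v_R0 v_nonzero Hv lam_\<alpha> by (simp add: eigenvector_on_def)
    qed
    ultimately show "index_saddle w A F k u \<and>
        (\<forall>i. the_eigenvector_on (R0 w) ?H (lam (pos i)) (v $ i))" by blast
  next
    assume B: "index_saddle w A F k u \<and>
        (\<forall>i. the_eigenvector_on (R0 w) ?H (lam (pos i)) (v $ i))"
    define \<alpha> where "\<alpha> i = lam (pos i)" for i :: 'k
    have G0: "Agrad w A F u = 0" using B by (simp add: index_saddle_def)
    have Hv: "?H (v $ i) = \<alpha> i *\<^sub>R v $ i" and simple: "eigen_mult_on (R0 w) ?H (\<alpha> i) = 1" for i
      using B by (auto simp: \<alpha>_def H.the_eigenvector_on_iff_simple eigenvector_on_def)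
    have p: "pos i \<in> {1..k}" for i :: 'k using range_pos[where 'k = 'k] k_card by auto
    have \<alpha>_neg: "\<alpha> i < 0" for i using lam_neg p by (simp add: \<alpha>_def)
    have \<alpha>_less: "\<alpha> i < \<alpha> j" if "i < j" for i j
    proof -
      have q: "pos i \<in> {1..CARD('n) - 1}" "pos j \<in> {1..CARD('n) - 1}" using p[of i] p[of j] k_le by auto
      have less: "pos i < pos j" using that by (rule pos_less)
      then have "\<alpha> i \<le> \<alpha> j" unfolding \<alpha>_def using mono_onD[OF mono q] by simp
      moreover have "\<alpha> i \<noteq> \<alpha> j"
      proof
        assume "\<alpha> i = \<alpha> j"
        then have "{pos i, pos j} \<subseteq> {l \<in> {1..CARD('n) - 1}. lam l = \<alpha> i}"
          using q by (auto simp: \<alpha>_def)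
        \<comment> \<open>Equal values at two positions would give multiplicity at least 2, against
          simplicity.\<close>
        then have "card {pos i, pos j} \<le> eigen_mult_on (R0 w) ?H (\<alpha> i)"
          unfolding mult by (intro card_mono) auto
        then show False using less simple[of i] by simp
      qed
      ultimately show ?thesis by simp
    qed
    have frame: "eigenframe ip (R0 w) ?H (($) v) \<alpha>"
    proof
      show "ip (v $ i) (v $ j) = (if i = j then 1 else 0)" for i j
        using H.eigenvectors_orthogonal[OF v_R0 v_R0 Hv Hv, of i j] v_ip \<alpha>_less
        by (metis less_irrefl linorder_less_linear)
    qed (simp_all add: v_R0 Hv)
    then interpret frame: eigenframe ip "R0 w" ?H "($) v" \<alpha> .
    obtain E where "saddle_linearization ip (R0 w) ?H (($) v) \<alpha> (wmean w) (Ph w) 1 E"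
      and J: "(saddle_field w A F \<mu> m has_derivative
        saddle_linearization.J ip ?H (($) v) \<alpha> (wmean w) (Ph w) 1 E \<mu>) (at (u, v))"
      using saddle_field_linearization[OF F_C3 G0 frame] .
    then interpret L: saddle_linearization ip "R0 w" ?H "($) v" \<alpha> "wmean w" "Ph w" 1 E \<mu> by simp
    \<comment> \<open>Nondegeneracy excludes the eigenvalue 0, and a negative eigenvalue is some
      \<open>lam (pos i)\<close>, whose eigenvectors are multiples of \<open>v $ i\<close>.\<close>
    have nonpos: "\<exists>i c. x = c *\<^sub>R v $ i" if x: "x \<in> R0 w" "x \<noteq> 0" "?H x = l *\<^sub>R x" "l \<le> 0" for x l
    proof -
      have "l \<noteq> 0" using H_inj x by force
      then have "l \<in> lam ` {1..k}" using neg_eigenvalue x by force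
      then obtain i :: 'k where "l = lam (pos i)" using range_pos[where 'k = 'k] k_card by (metis imageE)
      moreover have "eigenvector_on (R0 w) ?H l x" using x by (simp add: eigenvector_on_def)
      ultimately show ?thesis using B unfolding the_eigenvector_on_def by blast
    qed
    have "0 < ip r (?H r)" if "r \<in> R0 w" "r \<noteq> 0" "\<And>j. ip (v $ j) r = 0" for r
      by (rule frame.complement_positive) (use nonpos that in blast)+
    then have "Re c < 0" if "complex_eigenvalue L.J c" for c
      by (rule L.stable_if_frame_ordered) (use \<alpha>_neg \<alpha>_less \<mu>_pos that in blast)+
    moreover have "saddle_field w A F \<mu> m (u, v) = 0"
    proof -
      have "(\<Sum>j | j < i. ip (v $ j) (\<alpha> i *\<^sub>R v $ i) *\<^sub>R v $ j) = 0" for i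
        by (intro sum.neutral) (auto simp: ip.scaleR_right frame.orthonormal)
      then show ?thesis
        by (simp add: saddle_field_eq G0 u_mean Ph_R0 v_R0 Hv Let_def ip.zero_right ip.scaleR_right v_ip
            zero_prod_def vec_eq_iff)
    qed
    ultimately show "linearly_stable_steady_state (saddle_field w A F \<mu> m) (u, v)"
      unfolding linearly_stable_steady_state_def using J by blast
  qed
qed

end
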